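(* Let $u,w\in S_n$ and fix a wiring diagram $D_0$ of $u$ (i.e. an expression $u=s_{i_1}\cdots s_{i_\ell}$ as a product of simple transpositions). Then the localization of the elliptic Schubert class of $\operatorname{GL}_n$ is $$\mathbf{E}_w(u)=\sum_D\operatorname{weight}(D),$$ where the sum is over all sub-wiring diagrams $D$ of $D_0$ whose permutation is $w$.
   Context: For a lattice $\Lambda$, $\mathbb{Q}[\Lambda]=\bigoplus_{\mu\in\Lambda}\mathbb{Q}\,e^{\pi i\mu}$ is the group algebra (formal symbols $e^{\pi i\mu}$). For $u\in\Lambda$, $\theta(u)=(e^{\pi iu}-e^{-\pi iu})\prod_{m>0}(1-q^me^{2\pi iu})(1-q^me^{-2\pi iu})\in\mathbb{Q}[\Lambda][[q]]$, and $$\mathsf{P}(x,y)=\frac{\theta(x-y)\theta(\hbar)}{\theta(y+\hbar)\theta(x)},\qquad \mathsf{Q}(x,y)=\frac{\theta(x+\hbar)\theta(y)}{\theta(y+\hbar)\theta(x)}.$$ **Elliptic Schubert classes for $\operatorname{GL}_n$.** Let $W=S_n$, $\Lambda=\bigoplus_{i=1}^n\mathbb{Z}z_i\oplus\bigoplus_{i=1}^n\mathbb{Z}\lambda_i\oplus\mathbb{Z}\hbar$, $\mathcal{Q}=\operatorname{Frac}\mathbb{Q}[\Lambda][[q]]$. $W\times W$ acts on $\mathcal{Q}$ by ${}^{wv^{\mathsf d}}z_i=z_{w(i)}$, ${}^{wv^{\mathsf d}}\lambda_i=\lambda_{v(i)}$, fixing $\hbar,q$. $\mathcal{Q}_{W^2}$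 is the free left $\mathcal{Q}$-module with basis $\{\delta_w\delta_v^{\mathsf d}\}_{w,v\in W}$ and product $a\,\delta_w\delta_v^{\mathsf d}\cdot a'\,\delta_{w'}\delta_{v'}^{\mathsf d}=a\cdot{}^{wv^{\mathsf d}}a'\,\delta_{ww'}\delta_{vv'}^{\mathsf d}$. For $1\le i\le n-1$ let $T_i=\delta_{s_i}^{\mathsf d}\big(\mathsf{P}(z_i-z_{i+1},\lambda_i-\lambda_{i+1})+\mathsf{Q}(z_i-z_{i+1},\lambda_i-\lambda_{i+1})\delta_{s_i}\big)$; these satisfy the Coxeter relations of $S_n$ (known), so $T_w$ is defined for $w\in S_n$. Define $b_{u,w}\in\mathcal{Q}$ by $\delta_u=\sum_{w\le u}b_{u,w}\,\delta^{\mathsf d}_{w^{-1}}T_w$ (and $b_{u,w}=0$ for $w\not\le u$); $\mathbf{E}_w(u)=b_{u,w}$. **Wiring diagrams.** The wiring diagram of an expression $u=s_{i_1}\cdots s_{i_\ell}$ (not necessarily reduced) consists of $n$ "red" strings at heights $1,\ldots,n$ (bottom to top), drawn over $\ell$ consecutive intervals from left to right, where in the $j$-th interval the strings at heights $i_j$ and $i_j+1$ cross. Strings are oriented from right (source) to left (target). Red strings are labelled by the heights of their targets (left ends). A sub-wiring diagram $D$ is given by a subset $J\subseteq\{1,\ldots,\ell\}$: one draws $n$ "blue" strings that cross in the $j$-th interval (at heights $i_j,i_j+1$) exactly when $j\in J$, and run horizontally otherwise. Blue strings are labelled by the heights of their sources (right ends). The permutation of $D$ is $\prod_{j\in J}s_{i_j}$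 (product in increasing order of $j$); equivalently it sends the height of the source of each blue string to the height of its target. For each $j$, let $a$ (resp. $b$) be the label of the red string which immediately to the left of the $j$-th crossing is at height $i_j$ (resp. $i_j+1$), and let $c$ (resp. $d$) be the label of the blue string which immediately to the right of the $j$-th interval is at height $i_j$ (resp. $i_j+1$). The local weight at $j$ is $\mathsf{Q}(\lambda_c-\lambda_d,z_a-z_b)$ if $j\in J$ and $\mathsf{P}(\lambda_c-\lambda_d,z_a-z_b)$ if $j\notin J$; $\operatorname{weight}(D)$ is the product of the local weights over $j=1,\ldots,\ell$. *)

theory Defs
  imports
    "HOL-Analysis.Analysis"
    "HOL-Library.Poly_Mapping"
    "HOL-Combinatorics.Perm"
    "HOL-Computational_Algebra.Fraction_Field"
begin

unbundle permutation_syntax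
no_notation fps_nth (infixl \<open>$\<close> 75)

text \<open>
  Throughout, the type \<^typ>\<open>'n::{finite,linorder}\<close> plays the role of the ordered set
  \<open>{1 < ... < n}\<close>, where \<open>n = CARD('n)\<close>; the symmetric group is the type \<^typ>\<open>'n perm\<close>, with
  product the composition of maps.
\<close>

section \<open>The lattice, its group algebra, and the coefficient field\<close>

datatype 'n gen = Zgen 'n | Lgen 'n | Hgen

text \<open>
  The linear order on generators is only there so that the library recognises the group
  algebra of the lattice as an integral domain.
\<close>

instantiation gen :: (linorder) linorder
begin

fun less_eq_gen :: "'a gen \<Rightarrow> 'a gen \<Rightarrow> bool" where
  "less_eq_gen (Zgen i) (Zgen j) \<longleftrightarrow> i \<le> j"
| "less_eq_gen (Zgen _) _ \<longleftrightarrow> True"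
| "less_eq_gen (Lgen _) (Zgen _) \<longleftrightarrow> False"
| "less_eq_gen (Lgen i) (Lgen j) \<longleftrightarrow> i \<le> j"
| "less_eq_gen (Lgen _) Hgen \<longleftrightarrow> True"
| "less_eq_gen Hgen x \<longleftrightarrow> x = Hgen"

definition less_gen :: "'a gen \<Rightarrow> 'a gen \<Rightarrow> bool" where
  "less_gen x y \<longleftrightarrow> x \<le> y \<and> \<not> y \<le> x"

instance
proof
  fix x y z :: "'a gen"
  show "x < y \<longleftrightarrow> x \<le> y \<and> \<not> y \<le> x" by (rule less_gen_def)
  show "x \<le> x" by (cases x) auto
  show "x \<le> y \<Longrightarrow> y \<le> z \<Longrightarrow> x \<le> z" by (cases x; cases y; cases z) auto
  show "x \<le> y \<Longrightarrow> y \<le> x \<Longrightarrow> x = y" by (cases x; cases y) auto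
  show "x \<le> y \<or> y \<le> x" by (cases x; cases y) auto
qed

end

type_synonym 'n lat = "'n gen \<Rightarrow>\<^sub>0 int"
type_synonym 'n galg = "'n lat \<Rightarrow>\<^sub>0 rat"
type_synonym 'n ser = "'n galg fps"
type_synonym 'n efield = "'n ser fract"

definition zvar :: "'n \<Rightarrow> 'n lat" where
  "zvar i = Poly_Mapping.single (Zgen i) 1"

definition lvar :: "'n \<Rightarrow> 'n lat" where
  "lvar i = Poly_Mapping.single (Lgen i) 1"

definition hbar :: "'n lat" where
  "hbar = Poly_Mapping.single Hgen 1"

text \<open>\<open>expi \<mu>\<close> is the formal symbol \<open>e\<^bsup>\<pi>i\<mu>\<^esup>\<close>.\<close>

definition expi :: "'n lat \<Rightarrow> 'n galg" where
  "expi \<mu> = Poly_Mapping.single \<mu> 1"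

text \<open>
  The infinite product is taken in the q-adic topology of power series
  (\<^term>\<open>fps_X\<close> is \<open>q\<close>); the index \<open>m\<close> is shifted by one.
\<close>

definition theta_factor :: "'n::linorder lat \<Rightarrow> nat \<Rightarrow> 'n ser" where
  "theta_factor u m =
     (1 - fps_X ^ m * fps_const (expi (u + u))) * (1 - fps_X ^ m * fps_const (expi (- (u + u))))"

definition theta :: "'n::linorder lat \<Rightarrow> 'n ser" where
  "theta u = fps_const (expi u - expi (- u)) * prodinf (\<lambda>m. theta_factor u (Suc m))"

lemma fps_convergent_prod:
  fixes f :: "nat \<Rightarrow> 'a::idom fps"
  assumes "\<And>m. \<exists>g. f m = 1 + fps_X ^ Suc m * g"
  shows "f has_prod prodinf f"
proof -
  define p where "p n = (\<Prod>i\<le>n. f i)" for n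
  obtain g where g: "\<And>m. f m = 1 + fps_X ^ Suc m * g m"
    using assms by metis
  have step: "fps_nth (p (Suc n)) k = fps_nth (p n) k" if "k \<le> n" for n k
  proof -
    have "p (Suc n) = p n + fps_X ^ Suc (Suc n) * (g (Suc n) * p n)"
      by (simp add: p_def g algebra_simps)
    then show ?thesis
      using that by (simp only: fps_add_nth fps_X_power_mult_nth) simp
  qed
  have stable: "fps_nth (p n) k = fps_nth (p k) k" if "k \<le> n" for n k
    using that by (induction n rule: dec_induct) (auto simp: step)
  define l where "l = Abs_fps (\<lambda>k. fps_nth (p k) k)"
  have "p \<longlonglongrightarrow> l"
    by (rule tendsto_fpsI) (auto simp: l_def eventually_sequentially intro: stable)
  moreover have "fps_nth l 0 = 1"
    by (simp add: l_def p_def g)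
  then have "l \<noteq> 0" by auto
  ultimately have "f has_prod l"
    unfolding has_prod_def raw_has_prod_def p_def[abs_def] by simp
  then show ?thesis
    using has_prod_unique by metis
qed

lemma theta_has_prod: "(\<lambda>m. theta_factor u (Suc m)) has_prod prodinf (\<lambda>m. theta_factor u (Suc m))"
proof (rule fps_convergent_prod)
  fix m
  let ?a = "fps_const (expi (u + u))" and ?b = "fps_const (expi (- (u + u)))"
  have "theta_factor u (Suc m) = 1 + fps_X ^ Suc m * (fps_X ^ Suc m * ?a * ?b - ?a - ?b)"
    unfolding theta_factor_def by (simp only: algebra_simps mult_1_left mult_1_right)
  then show "\<exists>g. theta_factor u (Suc m) = 1 + fps_X ^ Suc m * g" by blast
qed

definition Pfun :: "'n::linorder lat \<Rightarrow> 'n lat \<Rightarrow> 'n efield" where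
  "Pfun x y = Fract (theta (x - y) * theta hbar) (theta (y + hbar) * theta x)"

definition Qfun :: "'n::linorder lat \<Rightarrow> 'n lat \<Rightarrow> 'n efield" where
  "Qfun x y = Fract (theta (x + hbar) * theta y) (theta (y + hbar) * theta x)"

section \<open>The action of pairs of permutations\<close>

definition push :: "('a \<Rightarrow> 'b) \<Rightarrow> ('a \<Rightarrow>\<^sub>0 'c::comm_monoid_add) \<Rightarrow> ('b \<Rightarrow>\<^sub>0 'c)" where
  "push f p = (\<Sum>k\<in>Poly_Mapping.keys p. Poly_Mapping.single (f k) (Poly_Mapping.lookup p k))"

lemma push_superset:
  assumes "finite S" "Poly_Mapping.keys p \<subseteq> S"
  shows "push f p = (\<Sum>k\<in>S. Poly_Mapping.single (f k) (Poly_Mapping.lookup p k))"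
  unfolding push_def
  by (rule sum.mono_neutral_left) (use assms in \<open>auto simp: in_keys_iff\<close>)

lemma push_0 [simp]: "push f 0 = 0"
  by (simp add: push_def)

lemma push_single [simp]: "push f (Poly_Mapping.single k c) = Poly_Mapping.single (f k) c"
  by (cases "c = 0") (simp_all add: push_def)

lemma push_add: "push f (p + q) = push f p + push f q"
proof -
  let ?S = "Poly_Mapping.keys p \<union> Poly_Mapping.keys q"
  have *: "finite ?S" "Poly_Mapping.keys (p + q) \<subseteq> ?S"
    "Poly_Mapping.keys p \<subseteq> ?S" "Poly_Mapping.keys q \<subseteq> ?S"
    using Poly_Mapping.keys_add[of p q] by auto
  show ?thesis
    by (simp only: push_superset[OF *(1,2)] push_superset[OF *(1,3)] push_superset[OF *(1,4)]
        lookup_add single_add sum.distrib)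
qed

lemma poly_mapping_additive_induct [case_names single add]:
  fixes p :: "'a \<Rightarrow>\<^sub>0 'c::comm_monoid_add"
  assumes "\<And>k c. P (Poly_Mapping.single k c)" "\<And>p q. P p \<Longrightarrow> P q \<Longrightarrow> P (p + q)"
  shows "P p"
proof -
  have "P (\<Sum>k\<in>S. Poly_Mapping.single (k :: 'a) (c k))" if "finite S" for S c
    using that
  proof induction
    case empty
    show ?case using assms(1)[of undefined 0] by simp
  qed (auto intro: assms)
  moreover have "(\<Sum>k\<in>Poly_Mapping.keys p. Poly_Mapping.single k (Poly_Mapping.lookup p k)) = p"
    by (rule poly_mapping_eqI)
      (simp add: lookup_sum lookup_single when_def in_keys_iff)
  ultimately show ?thesis
    by (metis finite_keys)
qed

lemma push_push: "push f (push g p) = push (\<lambda>x. f (g x)) p"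
  by (induction p rule: poly_mapping_additive_induct) (simp_all add: push_add)

lemma push_id: "push (\<lambda>x. x) p = p"
  by (induction p rule: poly_mapping_additive_induct) (simp_all add: push_add)

lemma push_mult:
  fixes p q :: "'a::monoid_add \<Rightarrow>\<^sub>0 'c::semiring_0"
  assumes "\<And>x y. f (x + y) = f x + f y"
  shows "push f (p * q) = push f p * push f q"
proof (induction p rule: poly_mapping_additive_induct)
  case (single k c)
  show ?case
    by (induction q rule: poly_mapping_additive_induct)
      (simp_all add: mult_single assms push_add distrib_left)
qed (simp add: push_add distrib_right)

fun act_gen :: "'n perm \<Rightarrow> 'n perm \<Rightarrow> 'n gen \<Rightarrow> 'n gen" where
  "act_gen w v (Zgen i) = Zgen (w \<langle>$\<rangle> i)"
| "act_gen w v (Lgen i) = Lgen (v \<langle>$\<rangle> i)"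
| "act_gen w v Hgen = Hgen"

definition act_lat :: "'n perm \<Rightarrow> 'n perm \<Rightarrow> 'n lat \<Rightarrow> 'n lat" where
  "act_lat w v = push (act_gen w v)"

definition act_galg :: "'n perm \<Rightarrow> 'n perm \<Rightarrow> 'n galg \<Rightarrow> 'n galg" where
  "act_galg w v = push (act_lat w v)"

definition act_ser :: "'n perm \<Rightarrow> 'n perm \<Rightarrow> 'n ser \<Rightarrow> 'n ser" where
  "act_ser w v f = Abs_fps (\<lambda>k. act_galg w v (fps_nth f k))"

lemma act_gen_mult: "act_gen w v (act_gen w' v' g) = act_gen (w * w') (v * v') g"
  by (cases g) (simp_all add: apply_times)

lemma act_gen_1: "act_gen 1 1 g = g"
  by (cases g) simp_all

lemma act_lat_add: "act_lat w v (x + y) = act_lat w v x + act_lat w v y"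
  by (simp add: act_lat_def push_add)

lemma act_lat_mult: "act_lat w v (act_lat w' v' x) = act_lat (w * w') (v * v') x"
  by (simp add: act_lat_def push_push act_gen_mult)

lemma act_lat_1: "act_lat 1 1 x = x"
  using push_id[of x] by (simp add: act_lat_def act_gen_1[abs_def])

lemma act_galg_0: "act_galg w v 0 = 0"
  by (simp add: act_galg_def)

lemma act_galg_add: "act_galg w v (x + y) = act_galg w v x + act_galg w v y"
  by (simp add: act_galg_def push_add)

lemma act_galg_sum: "act_galg w v (sum f S) = (\<Sum>i\<in>S. act_galg w v (f i))"
  by (induction S rule: infinite_finite_induct) (simp_all add: act_galg_0 act_galg_add)

lemma act_galg_times: "act_galg w v (x * y) = act_galg w v x * act_galg w v y"
  by (simp add: act_galg_def push_mult act_lat_add)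

lemma act_galg_mult: "act_galg w v (act_galg w' v' x) = act_galg (w * w') (v * v') x"
  by (simp add: act_galg_def push_push act_lat_mult)

lemma act_galg_1: "act_galg 1 1 x = x"
  using push_id[of x] by (simp add: act_galg_def act_lat_1[abs_def])

lemma act_galg_one: "act_galg w v 1 = 1"
  unfolding act_galg_def single_one[symmetric] push_single
  by (simp add: act_lat_def)

lemma act_ser_0 [simp]: "act_ser w v 0 = 0"
  by (simp add: act_ser_def fps_eq_iff act_galg_0)

lemma act_ser_one [simp]: "act_ser w v 1 = 1"
  by (simp add: act_ser_def fps_eq_iff act_galg_0 act_galg_one)

lemma act_ser_add: "act_ser w v (f + g) = act_ser w v f + act_ser w v g"
  by (simp add: act_ser_def fps_eq_iff act_galg_add)

lemma act_ser_times: "act_ser w v (f * g) = act_ser w v f * act_ser w v g"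
  by (simp add: act_ser_def fps_eq_iff fps_mult_nth act_galg_sum act_galg_times)

lemma act_ser_mult: "act_ser w v (act_ser w' v' f) = act_ser (w * w') (v * v') f"
  by (simp add: act_ser_def fps_eq_iff act_galg_mult)

lemma act_ser_1 [simp]: "act_ser 1 1 f = f"
  by (simp add: act_ser_def fps_eq_iff act_galg_1)

lemma act_ser_eq_0_iff [simp]: "act_ser w v f = 0 \<longleftrightarrow> f = 0"
proof
  assume "act_ser w v f = 0"
  then have "act_ser (inverse w) (inverse v) (act_ser w v f) = 0" by simp
  then show "f = 0" by (simp add: act_ser_mult)
qed simp

lift_definition act :: "'n perm \<Rightarrow> 'n perm \<Rightarrow> 'n::linorder efield \<Rightarrow> 'n efield"
  is "\<lambda>w v x. (act_ser w v (fst x), act_ser w v (snd x))"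
  by (simp flip: act_ser_times)

lemma act_Fract: "act w v (Fract a b) = Fract (act_ser w v a) (act_ser w v b)"
  by transfer simp

lemma act_0 [simp]: "act w v 0 = 0"
  by (simp add: Zero_fract_def act_Fract)

lemma act_one [simp]: "act w v 1 = 1"
  by (simp add: One_fract_def act_Fract)

lemma act_add: "act w v (x + y) = act w v x + act w v y"
  by (cases x; cases y) (simp add: act_Fract act_ser_add act_ser_times)

lemma act_times: "act w v (x * y) = act w v x * act w v y"
  by (cases x; cases y) (simp add: act_Fract act_ser_times)

lemma act_mult: "act w v (act w' v' x) = act (w * w') (v * v') x"
  by (cases x) (simp add: act_Fract act_ser_mult)

lemma act_1 [simp]: "act 1 1 x = x"
  by (cases x) (simp add: act_Fract)

lemma act_sum: "act w v (sum f S) = (\<Sum>i\<in>S. act w v (f i))"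
  by (induction S rule: infinite_finite_induct) (simp_all add: act_add)

section \<open>The twisted group algebra\<close>

instance perm :: (finite) finite
proof
  have "finite (range (\<lambda>w :: 'a perm. perm.apply w))" by simp
  moreover have "inj (\<lambda>w :: 'a perm. perm.apply w)"
    by (rule injI) (simp add: perm_eq_iff)
  ultimately show "finite (UNIV :: 'a perm set)"
    using finite_imageD by blast
qed

text \<open>
  An element is given by its coefficients in the basis \<open>\<delta>\<^sub>w \<delta>\<^sub>v\<^sup>d\<close>.  The product below is the
  bilinear extension of the product rule recorded in lemma \<open>basis_mult\<close>.
\<close>

typedef (overloaded) 'n tgalg =
  "UNIV :: ('n perm \<Rightarrow> 'n perm \<Rightarrow> 'n::{finite,linorder} efield) set"
  morphisms tcoeff Tgalg
  by simp

setup_lifting type_definition_tgalg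

lemma tgalg_eqI: "(\<And>x y. tcoeff a x y = tcoeff b x y) \<Longrightarrow> a = b"
  by (simp add: tcoeff_inject[symmetric] fun_eq_iff)

instantiation tgalg :: ("{finite,linorder}") ring_1
begin

lift_definition zero_tgalg :: "'a tgalg" is "\<lambda>x y. 0" .

lift_definition one_tgalg :: "'a tgalg" is "\<lambda>x y. if x = 1 \<and> y = 1 then 1 else 0" .

lift_definition plus_tgalg :: "'a tgalg \<Rightarrow> 'a tgalg \<Rightarrow> 'a tgalg"
  is "\<lambda>f g x y. f x y + g x y" .

lift_definition minus_tgalg :: "'a tgalg \<Rightarrow> 'a tgalg \<Rightarrow> 'a tgalg"
  is "\<lambda>f g x y. f x y - g x y" .

lift_definition uminus_tgalg :: "'a tgalg \<Rightarrow> 'a tgalg"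
  is "\<lambda>f x y. - f x y" .

lift_definition times_tgalg :: "'a tgalg \<Rightarrow> 'a tgalg \<Rightarrow> 'a tgalg"
  is "\<lambda>f g x y. \<Sum>w\<in>UNIV. \<Sum>v\<in>UNIV. f w v * act w v (g (inverse w * x) (inverse v * y))" .

lemmas tcoeff_simps =
  zero_tgalg.rep_eq one_tgalg.rep_eq plus_tgalg.rep_eq minus_tgalg.rep_eq
  uminus_tgalg.rep_eq times_tgalg.rep_eq

instance
proof
  fix a b c :: "'a tgalg"
  show "a + b + c = a + (b + c)"
    by (rule tgalg_eqI) (simp add: tcoeff_simps add.assoc)
  show "a + b = b + a"
    by (rule tgalg_eqI) (simp add: tcoeff_simps add.commute)
  show "0 + a = a" "- a + a = 0" "a - b = a + - b"
    by (rule tgalg_eqI; simp add: tcoeff_simps)+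
  have "tcoeff (0 :: 'a tgalg) 1 1 \<noteq> tcoeff 1 1 1"
    by (simp add: tcoeff_simps)
  then show "(0 :: 'a tgalg) \<noteq> 1" by metis
  show "(a + b) * c = a * c + b * c"
    by (rule tgalg_eqI) (simp add: tcoeff_simps distrib_right sum.distrib)
  show "a * (b + c) = a * b + a * c"
    by (rule tgalg_eqI) (simp add: tcoeff_simps distrib_left sum.distrib act_add)
  have if_act: "(if P then x else 0) * y = (if P then x * y else 0)"
    "x * (if P then y else 0) = (if P then x * y else 0)"
    "act w v (if P then x else 0) = (if P then act w v x else 0)" for P and x y :: "'a efield" and w v
    by auto
  have delta: "(\<Sum>w\<in>UNIV. \<Sum>v\<in>UNIV. if w = p \<and> v = r then F w v else 0) = F p r"
    for p r :: "'a perm" and F :: "_ \<Rightarrow> _ \<Rightarrow> 'a efield"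
  proof -
    have "(\<Sum>w\<in>UNIV. \<Sum>v\<in>UNIV. if w = p \<and> v = r then F w v else 0) =
        (\<Sum>w\<in>UNIV. if w = p then (\<Sum>v\<in>UNIV. if v = r then F w v else 0) else 0)"
      by (intro sum.cong refl) simp
    then show ?thesis by simp
  qed
  have inv: "inverse w * x = 1 \<longleftrightarrow> w = x" for w x :: "'a perm"
    by (metis mult.assoc mult_1_left mult_1_right perm.left_inverse perm.right_inverse)
  show "1 * a = a"
    by (rule tgalg_eqI) (simp add: tcoeff_simps if_act delta)
  show "a * 1 = a"
    by (rule tgalg_eqI) (simp add: tcoeff_simps if_act delta inv)
  show "a * b * c = a * (b * c)"
  proof (rule tgalg_eqI)
    fix x y
    define f g h where "f = tcoeff a" and "g = tcoeff b" and "h = tcoeff c"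
    have bij: "bij (\<lambda>w'. w * w')" for w :: "'a perm"
      by (rule o_bij[where g = "\<lambda>w'. inverse w * w'"]) (simp_all add: fun_eq_iff flip: mult.assoc)
    define F where "F w v w' v' = f w v * act w v (g (inverse w * w') (inverse v * v')) *
        act w' v' (h (inverse w' * x) (inverse v' * y))" for w v w' v'
    have "(\<Sum>w'\<in>UNIV. \<Sum>v'\<in>UNIV. (\<Sum>w\<in>UNIV. \<Sum>v\<in>UNIV. f w v *
          act w v (g (inverse w * w') (inverse v * v'))) *
          act w' v' (h (inverse w' * x) (inverse v' * y)))
      = (\<Sum>w'\<in>UNIV. \<Sum>v'\<in>UNIV. \<Sum>w\<in>UNIV. \<Sum>v\<in>UNIV. F w v w' v')"
      by (simp add: F_def sum_distrib_right)
    also have "\<dots> = (\<Sum>w'\<in>UNIV. \<Sum>w\<in>UNIV. \<Sum>v'\<in>UNIV. \<Sum>v\<in>UNIV. F w v w' v')"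
      by (rule sum.cong[OF refl], rule sum.swap)
    also have "\<dots> = (\<Sum>w\<in>UNIV. \<Sum>w'\<in>UNIV. \<Sum>v'\<in>UNIV. \<Sum>v\<in>UNIV. F w v w' v')"
      by (rule sum.swap)
    also have "\<dots> = (\<Sum>w\<in>UNIV. \<Sum>w'\<in>UNIV. \<Sum>v\<in>UNIV. \<Sum>v'\<in>UNIV. F w v w' v')"
      by (rule sum.cong[OF refl], rule sum.cong[OF refl], rule sum.swap)
    also have "\<dots> = (\<Sum>w\<in>UNIV. \<Sum>v\<in>UNIV. \<Sum>w'\<in>UNIV. \<Sum>v'\<in>UNIV. F w v w' v')"
      by (rule sum.cong[OF refl], rule sum.swap)
    also have "\<dots> = (\<Sum>w\<in>UNIV. \<Sum>v\<in>UNIV. \<Sum>w'\<in>UNIV. \<Sum>v'\<in>UNIV. F w v (w * w') (v * v'))"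
    proof (rule sum.cong[OF refl], rule sum.cong[OF refl])
      fix w v
      have "(\<Sum>w'\<in>UNIV. \<Sum>v'\<in>UNIV. F w v w' v') = (\<Sum>w'\<in>UNIV. \<Sum>v'\<in>UNIV. F w v (w * w') v')"
        by (rule sum.reindex_bij_betw[symmetric]) (rule bij)
      also have "\<dots> = (\<Sum>w'\<in>UNIV. \<Sum>v'\<in>UNIV. F w v (w * w') (v * v'))"
        by (rule sum.cong[OF refl], rule sum.reindex_bij_betw[symmetric]) (rule bij)
      finally show "(\<Sum>w'\<in>UNIV. \<Sum>v'\<in>UNIV. F w v w' v') =
          (\<Sum>w'\<in>UNIV. \<Sum>v'\<in>UNIV. F w v (w * w') (v * v'))" .
    qed
    also have "\<dots> = (\<Sum>w\<in>UNIV. \<Sum>v\<in>UNIV. f w v * act w v (\<Sum>w'\<in>UNIV. \<Sum>v'\<in>UNIV.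
        g w' v' * act w' v' (h (inverse w' * (inverse w * x)) (inverse v' * (inverse v * y)))))"
    proof -
      have "inverse w * (w * w') = w'" for w w' :: "'a perm"
        by (simp flip: mult.assoc)
      then show ?thesis
        by (simp add: F_def act_sum sum_distrib_left act_times act_mult mult.assoc)
    qed
    finally show "tcoeff (a * b * c) x y = tcoeff (a * (b * c)) x y"
      by (simp only: tcoeff_simps f_def g_def h_def)
  qed
qed

end

text \<open>\<open>basis a w v\<close> is \<open>a \<delta>\<^sub>w \<delta>\<^sub>v\<^sup>d\<close>.\<close>

definition basis :: "'n::{finite,linorder} efield \<Rightarrow> 'n perm \<Rightarrow> 'n perm \<Rightarrow> 'n tgalg" where
  "basis a w v = Tgalg (\<lambda>x y. if x = w \<and> y = v then a else 0)"

lemma tcoeff_basis: "tcoeff (basis a w v) x y = (if x = w \<and> y = v then a else 0)"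
  by (simp add: basis_def Tgalg_inverse)

abbreviation scal :: "'n::{finite,linorder} efield \<Rightarrow> 'n tgalg" where
  "scal a \<equiv> basis a 1 1"

abbreviation del :: "'n::{finite,linorder} perm \<Rightarrow> 'n tgalg" where
  "del w \<equiv> basis 1 w 1"

abbreviation deld :: "'n::{finite,linorder} perm \<Rightarrow> 'n tgalg" where
  "deld v \<equiv> basis 1 1 v"

lemma basis_mult:
  "basis a w v * basis a' w' v' = basis (a * act w v a') (w * w') (v * v')"
proof (rule tgalg_eqI)
  fix x y
  have eq: "inverse w * x = w' \<longleftrightarrow> x = w * w'" for w x w' :: "'b perm"
    by (metis mult.assoc mult_1_left perm.left_inverse perm.right_inverse)
  have if_mult: "(if p = w \<and> r = v then a else 0) * c =
      (if p = w then if r = v then a * c else 0 else 0)" for p r c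
    by simp
  have "(\<Sum>p\<in>UNIV. \<Sum>r\<in>UNIV. (if p = w \<and> r = v then a else 0) *
          act p r (if inverse p * x = w' \<and> inverse r * y = v' then a' else 0))
      = (\<Sum>p\<in>UNIV. if p = w then (\<Sum>r\<in>UNIV. if r = v then
          a * act p r (if inverse p * x = w' \<and> inverse r * y = v' then a' else 0) else 0) else 0)"
    unfolding if_mult by (intro sum.cong refl) (simp split: if_split)
  also have "\<dots> = a * act w v (if inverse w * x = w' \<and> inverse v * y = v' then a' else 0)"
    by (simp only: sum.delta finite UNIV_I if_True)
  also have "\<dots> = (if x = w * w' \<and> y = v * v' then a * act w v a' else 0)"
    by (simp add: eq)
  finally show "tcoeff (basis a w v * basis a' w' v') x y =
      tcoeff (basis (a * act w v a') (w * w') (v * v')) x y"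
    by (simp add: times_tgalg.rep_eq tcoeff_basis)
qed

section \<open>Simple transpositions, length and Bruhat order\<close>

text \<open>The simple transpositions are \<open>simple i\<close> for the non-maximal \<open>i\<close>.\<close>

definition nxt :: "'n::{finite,linorder} \<Rightarrow> 'n" where
  "nxt i = Min {k. i < k}"

definition simple :: "'n::{finite,linorder} \<Rightarrow> 'n perm" where
  "simple i = \<langle>i \<leftrightarrow> nxt i\<rangle>"

definition simple_word :: "'n::{finite,linorder} list \<Rightarrow> bool" where
  "simple_word ws \<longleftrightarrow> (\<forall>i\<in>set ws. \<exists>k. i < k)"

definition word_perm :: "'n::{finite,linorder} list \<Rightarrow> 'n perm" where
  "word_perm ws = prod_list (map simple ws)"

definition perm_length :: "'n::{finite,linorder} perm \<Rightarrow> nat" where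
  "perm_length w = (LEAST k. \<exists>ws. simple_word ws \<and> word_perm ws = w \<and> length ws = k)"

definition reduced_word :: "'n::{finite,linorder} list \<Rightarrow> 'n perm \<Rightarrow> bool" where
  "reduced_word ws w \<longleftrightarrow> simple_word ws \<and> word_perm ws = w \<and> length ws = perm_length w"

definition bruhat_step :: "'n::{finite,linorder} perm \<Rightarrow> 'n perm \<Rightarrow> bool" where
  "bruhat_step v w \<longleftrightarrow> (\<exists>a b. a \<noteq> b \<and> w = v * \<langle>a \<leftrightarrow> b\<rangle> \<and> perm_length v < perm_length w)"

definition bruhat_le :: "'n::{finite,linorder} perm \<Rightarrow> 'n perm \<Rightarrow> bool" where
  "bruhat_le = bruhat_step\<^sup>*\<^sup>*"

section \<open>Elliptic Demazure-Lusztig elements and elliptic Schubert classes\<close>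

definition Tsimple :: "'n::{finite,linorder} \<Rightarrow> 'n tgalg" where
  "Tsimple i = deld (simple i) *
     (scal (Pfun (zvar i - zvar (nxt i)) (lvar i - lvar (nxt i))) +
      scal (Qfun (zvar i - zvar (nxt i)) (lvar i - lvar (nxt i))) * del (simple i))"

text \<open>
  As the \<open>Tsimple i\<close> satisfy the Coxeter relations, the choice of a reduced word below
  is immaterial.
\<close>

definition Tperm :: "'n::{finite,linorder} perm \<Rightarrow> 'n tgalg" where
  "Tperm w = prod_list (map Tsimple (SOME ws. reduced_word ws w))"

definition schubert_coeffs :: "'n::{finite,linorder} perm \<Rightarrow> 'n perm \<Rightarrow> 'n efield" where
  "schubert_coeffs u = (THE b.
     (\<forall>w. \<not> bruhat_le w u \<longrightarrow> b w = 0) \<and>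
     del u = (\<Sum>w | bruhat_le w u. scal (b w) * deld (inverse w) * Tperm w))"

definition ell_schubert :: "'n::{finite,linorder} perm \<Rightarrow> 'n perm \<Rightarrow> 'n efield" where
  "ell_schubert w u = schubert_coeffs u w"

section \<open>Wiring diagrams\<close>

text \<open>
  A wiring diagram is a word \<open>ws\<close>.  Its crossings are numbered \<open>0, ..., \<ell> - 1\<close> from left to
  right, and crossing \<open>j\<close> lies between column \<open>j\<close> on its left and column \<open>j + 1\<close> on its right.
  \<open>red_height ws j h\<close> is the height in column \<open>j\<close> of the red string whose target (in column \<open>0\<close>)
  has height \<open>h\<close>; \<open>blue_height ws J j h\<close> is the height in column \<open>j\<close> of the blue string whose
  source (in column \<open>\<ell>\<close>) has height \<open>h\<close>.
\<close>

fun red_height :: "'n::{finite,linorder} list \<Rightarrow> nat \<Rightarrow> 'n \<Rightarrow> 'n" where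
  "red_height ws 0 h = h"
| "red_height ws (Suc j) h = simple (ws ! j) \<langle>$\<rangle> (red_height ws j h)"

function blue_height :: "'n::{finite,linorder} list \<Rightarrow> nat set \<Rightarrow> nat \<Rightarrow> 'n \<Rightarrow> 'n" where
  "blue_height ws J j h =
     (if j \<ge> length ws then h
      else if j \<in> J then simple (ws ! j) \<langle>$\<rangle> (blue_height ws J (Suc j) h)
      else blue_height ws J (Suc j) h)"
  by pat_completeness auto
termination by (relation "Wellfounded.measure (\<lambda>(ws, J, j, h). length ws - j)") auto

declare blue_height.simps [simp del]

definition red_label :: "'n::{finite,linorder} list \<Rightarrow> nat \<Rightarrow> 'n \<Rightarrow> 'n" where
  "red_label ws j k = (THE h. red_height ws j h = k)"

definition blue_label :: "'n::{finite,linorder} list \<Rightarrow> nat set \<Rightarrow> nat \<Rightarrow> 'n \<Rightarrow> 'n" where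
  "blue_label ws J j k = (THE h. blue_height ws J j h = k)"

definition local_weight :: "'n::{finite,linorder} list \<Rightarrow> nat set \<Rightarrow> nat \<Rightarrow> 'n efield" where
  "local_weight ws J j =
     (let a = red_label ws j (ws ! j); b = red_label ws j (nxt (ws ! j));
          c = blue_label ws J (Suc j) (ws ! j); d = blue_label ws J (Suc j) (nxt (ws ! j))
      in (if j \<in> J then Qfun else Pfun) (lvar c - lvar d) (zvar a - zvar b))"

definition weight :: "'n::{finite,linorder} list \<Rightarrow> nat set \<Rightarrow> 'n efield" where
  "weight ws J = (\<Prod>j<length ws. local_weight ws J j)"

definition diagram_perm :: "'n::{finite,linorder} list \<Rightarrow> nat set \<Rightarrow> 'n perm" where
  "diagram_perm ws J = word_perm (nths ws J)"

end

theory Submission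
  imports Defs
begin

text \<open>
  Since \<open>Q(x, y) Q(y, x) = 1\<close> and \<open>P(x, y) + Q(x, y) P(y, x) = 0\<close>, the definition of \<open>T\<^sub>i\<close> inverts to
  \<open>\<delta>\<^sub>i = P(\<lambda>, z) + Q(\<lambda>, z) \<delta>\<^sub>i\<^sup>d T\<^sub>i\<close>.  Multiplying these expressions along the word of \<open>u\<close> expands \<open>\<delta>\<^sub>u\<close>
  over the sub-diagrams, each contributing its weight times \<open>\<delta>\<^sup>d T\<^sub>w\<close>, where \<open>w\<close> is its permutation and
  \<open>\<delta>\<^sup>d\<close> is taken at \<open>w\<^bsup>-1\<^esup>\<close>: the red labels record the action of the \<open>\<delta>\<close>s to the left of a
  factor, the blue labels that of the \<open>\<delta>\<^sup>d\<close>s produced on its right.  The elements \<open>\<delta>\<^sup>d T\<^sub>w\<close> are as many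
  as the \<open>\<delta>\<^sub>u\<close> they generate, hence independent; so the coefficients do not depend on the word, and a
  reduced word shows that only \<open>w \<le> u\<close> occur.

  As the word need not be reduced, this uses \<open>T\<^sub>i\<^sup>2 = 1\<close> as well as the braid relations, all of which
  come down to the three-term identity for \<open>\<theta>\<close>.  By the Jacobi triple product, \<open>\<theta>(p) \<theta>(r)\<close> is, up to
  a constant, a \<open>2 \<times> 2\<close> minor formed by the values at \<open>p + r\<close> and \<open>p - r\<close> of two theta functions of
  level two, and the three-term identity is the Pluecker relation between such minors.
\<close>

section \<open>The finite triple product\<close>

text \<open>Gaussian binomial coefficients; the q-Pascal recursion defines them without
  division.\<close>

fun qbin :: "nat \<Rightarrow> nat \<Rightarrow> 'a::comm_ring_1 fps" where
  "qbin n 0 = 1"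
| "qbin 0 (Suc k) = 0"
| "qbin (Suc n) (Suc k) = qbin n k + fps_X ^ Suc k * qbin n (Suc k)"

definition qpoch :: "nat \<Rightarrow> 'a::comm_ring_1 fps" where
  "qpoch n = (\<Prod>m<n. 1 - fps_X ^ Suc m)"

lemma qbin_eq_0: "n < k \<Longrightarrow> qbin n k = 0"
  by (induction n k rule: qbin.induct) auto

lemma qbin_self [simp]: "qbin n n = 1"
  by (induction n) (auto simp: qbin_eq_0)

lemma qpoch_0 [simp]: "qpoch 0 = 1"
  by (simp add: qpoch_def)

lemma qpoch_Suc: "qpoch (Suc n) = qpoch n * (1 - fps_X ^ Suc n)"
  by (simp add: qpoch_def)

text \<open>Induction on \<open>k + l\<close> by the q-Pascal rule; the two terms combine through
  \<open>(1 - q^k) + q^k (1 - q^l) = 1 - q^(k+l)\<close>. This is the factorial formula, free of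
  division.\<close>

lemma qbin_add_qpoch: "qbin (k + l) k * qpoch k * qpoch l = (qpoch (k + l) :: 'a::comm_ring_1 fps)"
proof (induction "k + l" arbitrary: k l)
  case 0
  then show ?case by simp
next
  case (Suc n)
  show ?case
  proof (cases k)
    case 0
    then show ?thesis by simp
  next
    case k: (Suc k')
    show ?thesis
    proof (cases l)
      case 0
      then show ?thesis by simp
    next
      case l: (Suc l')
      have n: "n = k' + l" "n = k + l'" using Suc.hyps(2) k l by auto
      have 1: "qbin n k' * qpoch k' * qpoch l = (qpoch n :: 'a fps)"
        using Suc.hyps(1)[of k' l] n by simp
      have 2: "qbin n k * qpoch k * qpoch l' = (qpoch n :: 'a fps)"
        using Suc.hyps(1)[of k l'] n by simp
      have "qbin (k + l) k = (qbin n k' + fps_X ^ k * qbin n k :: 'a fps)"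
        using k n Suc.hyps(2) by (metis qbin.simps(3))
      then have "qbin (k + l) k * qpoch k * qpoch l =
          (qbin n k' * qpoch k' * qpoch l) * (1 - fps_X ^ k)
          + fps_X ^ k * (qbin n k * qpoch k * qpoch l') * (1 - fps_X ^ l :: 'a fps)"
        by (simp add: k l qpoch_Suc algebra_simps)
      also have "\<dots> = qpoch n * (1 - fps_X ^ (k + l))"
        unfolding 1 2 by (simp add: algebra_simps power_add)
      also have "\<dots> = qpoch (k + l)"
        by (simp add: qpoch_Suc flip: Suc.hyps(2))
      finally show ?thesis .
    qed
  qed
qed

text \<open>Induction on \<open>n\<close> for all \<open>x\<close> at once: after the factor for
  \<open>i = 0\<close> is split off, the remaining product is the one for \<open>fps_X * x\<close>.
  The q-Pascal rule merges the two resulting sums.\<close>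

lemma q_binomial_theorem:
  fixes x y :: "'a::comm_ring_1 fps"
  shows "(\<Prod>i<n. y + fps_X ^ i * x) =
    (\<Sum>k\<le>n. fps_X ^ (k choose 2) * qbin n k * x ^ k * y ^ (n - k))"
proof (induction n arbitrary: x)
  case 0
  then show ?case by (simp add: binomial_eq_0)
next
  case (Suc n)
  let ?q = "fps_X :: 'a fps"
  define S where "S = (\<Sum>k\<le>n. ?q ^ (Suc k choose 2) * qbin n k * x ^ k * y ^ (n - k))"
  have choose: "Suc k choose 2 = (k choose 2) + k" for k
    by (simp add: numeral_2_eq_2)
  have "(\<Prod>i<Suc n. y + ?q ^ i * x) = (y + x) * (\<Prod>i<n. y + ?q ^ i * (?q * x))"
    by (subst prod.lessThan_Suc_shift) (simp add: algebra_simps)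
  also have "(\<Prod>i<n. y + ?q ^ i * (?q * x)) = S"
    unfolding Suc.IH S_def
    by (intro sum.cong) (simp_all add: choose power_mult_distrib power_add algebra_simps)
  also have "(y + x) * S = y * S + x * S"
    by (simp add: algebra_simps)
  also have "x * S = (\<Sum>k\<le>n. ?q ^ (Suc k choose 2) * qbin n k * x ^ Suc k * y ^ (n - k))"
    by (simp add: S_def sum_distrib_left algebra_simps)
  also have "y * S = (\<Sum>k\<le>n. ?q ^ (Suc k choose 2) * qbin n k * x ^ k * y ^ (Suc n - k))"
    by (simp add: S_def sum_distrib_left algebra_simps Suc_diff_le)
  also have "\<dots> = (\<Sum>k\<le>Suc n. ?q ^ (Suc k choose 2) * qbin n k * x ^ k * y ^ (Suc n - k))"
    by (simp add: qbin_eq_0)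
  also have "\<dots> = y ^ Suc n + (\<Sum>k\<le>n. ?q ^ (Suc (Suc k) choose 2) * qbin n (Suc k) * x ^ Suc k * y ^ (n - k))"
    by (subst sum.atMost_Suc_shift) (simp add: numeral_2_eq_2)
  also have "\<dots> + (\<Sum>k\<le>n. ?q ^ (Suc k choose 2) * qbin n k * x ^ Suc k * y ^ (n - k)) =
      y ^ Suc n + (\<Sum>k\<le>n. ?q ^ (Suc k choose 2) * qbin (Suc n) (Suc k) * x ^ Suc k * y ^ (n - k))"
    by (simp add: choose power_add algebra_simps sum.distrib)
  also have "\<dots> = (\<Sum>k\<le>Suc n. ?q ^ (k choose 2) * qbin (Suc n) k * x ^ k * y ^ (Suc n - k))"
    by (subst sum.atMost_Suc_shift) (simp add: numeral_2_eq_2)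
  finally show ?case .
qed

text \<open>Extends \<open>j choose 2\<close> to negative \<open>j\<close>; since
  \<open>j * (j - 1)\<close> is even and nonnegative, this is a natural number usable as an
  exponent.\<close>

definition ichoose2 :: "int \<Rightarrow> nat" where
  "ichoose2 j = nat (j * (j - 1) div 2)"

lemma int_ichoose2: "2 * int (ichoose2 j) = j * (j - 1)"
proof -
  have "j * (j - 1) \<ge> 0" by (auto simp: zero_le_mult_iff)
  moreover have "even (j * (j - 1))" by auto
  ultimately show ?thesis by (auto simp: ichoose2_def)
qed

text \<open>Recentring at \<open>k = N\<close>: the exponents of \<open>q\<close> in the terms of
  the q-binomial theorem share a part that does not depend on \<open>k\<close>.\<close>

lemma ichoose2_diff:
  assumes "k \<le> 2 * N + 1"
  shows "(k choose 2) + N * (2 * N + 1 - k) = ((N choose 2) + N * (N + 1)) + ichoose2 (int k - int N)"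
proof -
  have c: "2 * int (n choose 2) = int n * (int n - 1)" for n
    by (induction n) (simp_all add: numeral_2_eq_2 algebra_simps)
  obtain l where l: "2 * N + 1 = k + l"
    using assms le_Suc_ex by blast
  then have "int l = 2 * int N + 1 - int k" by linarith
  then have "2 * int ((k choose 2) + N * l) =
        2 * int (((N choose 2) + N * (N + 1)) + ichoose2 (int k - int N))"
    by (simp add: distrib_left c int_ichoose2) (simp add: algebra_simps)
  then have "(k choose 2) + N * l = ((N choose 2) + N * (N + 1)) + ichoose2 (int k - int N)"
    by (simp only: mult_cancel_left of_nat_eq_iff) simp
  then show ?thesis by (simp only: l add_diff_cancel_left')
qed

text \<open>This is \<open>q_binomial_theorem\<close> for \<open>n = 2N + 1\<close>, \<open>x = -t\<close>, \<open>y = q\<^sup>N\<close>, divided by the power of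
  \<open>q\<close> common to all terms; taking \<open>y = q\<^sup>N\<close> avoids the negative power of \<open>q\<close> in the usual choice
  \<open>x = -t q\<^bsup>-N\<^esup>\<close>, \<open>y = 1\<close>.\<close>

lemma finite_triple_product:
  fixes t s :: "'a::idom fps"
  assumes "t * s = 1"
  shows "(- t) ^ N * (1 - t) * (\<Prod>m<N. (1 - fps_X ^ Suc m * t) * (1 - fps_X ^ Suc m * s)) =
    (\<Sum>k\<le>2*N+1. fps_X ^ ichoose2 (int k - int N) * qbin (2*N+1) k * (- t) ^ k)"
proof -
  let ?q = "fps_X :: 'a fps"
  let ?L = "(N choose 2) + N * (N + 1)"
  have gauss: "(\<Prod>i<N. ?q ^ i) = ?q ^ (N choose 2)"
    by (induction N) (simp_all add: numeral_2_eq_2 power_add)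
  \<comment> \<open>Pulling \<open>- t * q^i\<close> out of the factors with \<open>i < N\<close>
    turns them into factors in \<open>s\<close>, the inverse of \<open>t\<close>. The factors with
    \<open>i > N\<close> give those in \<open>t\<close>, and \<open>i = N\<close> gives
    \<open>1 - t\<close>.\<close>
  have low: "(\<Prod>i<N. ?q ^ N + ?q ^ i * - t) = (- t) ^ N * ?q ^ (N choose 2) * (\<Prod>m<N. 1 - ?q ^ Suc m * s)"
  proof -
    have "(\<Prod>i<N. ?q ^ N + ?q ^ i * - t) = (\<Prod>i<N. (- t) * ?q ^ i * (1 - ?q ^ (N - i) * s))"
    proof (rule prod.cong[OF refl])
      fix i assume "i \<in> {..<N}"
      then have "?q ^ N = ?q ^ i * ?q ^ (N - i)" by (simp flip: power_add)
      then have "?q ^ N = ?q ^ i * ?q ^ (N - i) * (t * s)" using assms by simp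
      then show "?q ^ N + ?q ^ i * - t = (- t) * ?q ^ i * (1 - ?q ^ (N - i) * s)"
        by (simp add: algebra_simps)
    qed
    also have "\<dots> = (- t) ^ N * ?q ^ (N choose 2) * (\<Prod>i<N. 1 - ?q ^ (N - i) * s)"
      by (simp only: prod.distrib gauss prod_constant card_lessThan)
    also have "(\<Prod>i<N. 1 - ?q ^ (N - i) * s) = (\<Prod>m<N. 1 - ?q ^ Suc m * s)"
      by (subst prod.nat_diff_reindex[symmetric]) (auto intro!: prod.cong simp: Suc_diff_Suc)
    finally show ?thesis .
  qed
  have high: "(\<Prod>i<N. ?q ^ N + ?q ^ (N + Suc i) * - t) = ?q ^ (N * N) * (\<Prod>m<N. 1 - ?q ^ Suc m * t)"
  proof -
    have "(\<Prod>i<N. ?q ^ N + ?q ^ (N + Suc i) * - t) = (\<Prod>i<N. ?q ^ N * (1 - ?q ^ Suc i * t))"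
      by (intro prod.cong refl) (simp add: power_add algebra_simps)
    then show ?thesis
      by (simp add: prod.distrib power_mult)
  qed
  have "(\<Prod>i<2*N+1. ?q ^ N + ?q ^ i * - t) =
      (\<Prod>i<N. ?q ^ N + ?q ^ i * - t) * (\<Prod>i<Suc N. ?q ^ N + ?q ^ (N + i) * - t)"
  proof -
    have split: "prod g {..<a + b} = prod g {..<a} * (\<Prod>i<b. g (a + i))" for g :: "nat \<Rightarrow> 'a fps" and a b
      by (induction b) (simp_all add: mult.assoc)
    have "2 * N + 1 = N + Suc N" by simp
    then show ?thesis by (simp only: split)
  qed
  also have "(\<Prod>i<Suc N. ?q ^ N + ?q ^ (N + i) * - t) =
      ?q ^ N * (1 - t) * (?q ^ (N * N) * (\<Prod>m<N. 1 - ?q ^ Suc m * t))"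
    unfolding prod.lessThan_Suc_shift o_def high by (simp add: algebra_simps)
  also note low
  also have "(- t) ^ N * ?q ^ (N choose 2) * (\<Prod>m<N. 1 - ?q ^ Suc m * s) *
      (?q ^ N * (1 - t) * (?q ^ (N * N) * (\<Prod>m<N. 1 - ?q ^ Suc m * t))) =
      ?q ^ ?L * ((- t) ^ N * (1 - t) * (\<Prod>m<N. (1 - ?q ^ Suc m * t) * (1 - ?q ^ Suc m * s)))"
    by (simp only: prod.distrib power_add distrib_left mult_1_right mult_1_left mult_ac)
  finally have "?q ^ ?L * ((- t) ^ N * (1 - t) *
      (\<Prod>m<N. (1 - ?q ^ Suc m * t) * (1 - ?q ^ Suc m * s))) =
      (\<Sum>k\<le>2*N+1. ?q ^ (k choose 2) * qbin (2*N+1) k * (- t) ^ k * (?q ^ N) ^ (2*N+1 - k))"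
    by (simp only: q_binomial_theorem)
  also have "\<dots> = (\<Sum>k\<le>2*N+1. ?q ^ ?L * (?q ^ ichoose2 (int k - int N) * qbin (2*N+1) k * (- t) ^ k))"
  proof (rule sum.cong[OF refl])
    fix k assume "k \<in> {..2*N+1}"
    then have exponent: "?q ^ (k choose 2) * (?q ^ N) ^ (2*N+1 - k) = ?q ^ ?L * ?q ^ ichoose2 (int k - int N)"
      using ichoose2_diff[of k N] by (simp only: power_add[symmetric] power_mult[symmetric]) simp
    have "?q ^ (k choose 2) * qbin (2*N+1) k * (- t) ^ k * (?q ^ N) ^ (2*N+1 - k) =
        (?q ^ (k choose 2) * (?q ^ N) ^ (2*N+1 - k)) * (qbin (2*N+1) k * (- t) ^ k)"
      by (simp only: mult_ac)
    then show "?q ^ (k choose 2) * qbin (2*N+1) k * (- t) ^ k * (?q ^ N) ^ (2*N+1 - k) =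
        ?q ^ ?L * (?q ^ ichoose2 (int k - int N) * qbin (2*N+1) k * (- t) ^ k)"
      unfolding exponent by (simp only: mult.assoc)
  qed
  also have "\<dots> = ?q ^ ?L * (\<Sum>k\<le>2*N+1. ?q ^ ichoose2 (int k - int N) * qbin (2*N+1) k * (- t) ^ k)"
    by (simp only: sum_distrib_left)
  finally show ?thesis
    unfolding mult_cancel_left power_eq_0_iff by (auto simp only: fps_X_neq_zero)
qed

section \<open>Coefficientwise limits\<close>

text \<open>Congruence modulo \<open>fps_X ^ Suc K\<close>. It stands in for limits: an infinite
  product is congruent to all its late partial products.\<close>

definition fps_agree :: "nat \<Rightarrow> 'a::comm_ring_1 fps \<Rightarrow> 'a fps \<Rightarrow> bool" where
  "fps_agree K f g \<longleftrightarrow> (\<forall>i\<le>K. fps_nth f i = fps_nth g i)"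

lemma fps_agree_refl [simp]: "fps_agree K f f"
  by (simp add: fps_agree_def)

lemma fps_agree_sym: "fps_agree K f g \<Longrightarrow> fps_agree K g f"
  by (simp add: fps_agree_def)

lemma fps_agree_trans [trans]: "fps_agree K f g \<Longrightarrow> fps_agree K g h \<Longrightarrow> fps_agree K f h"
  by (simp add: fps_agree_def)

lemma fps_agree_mult: "fps_agree K f f' \<Longrightarrow> fps_agree K g g' \<Longrightarrow> fps_agree K (f * g) (f' * g')"
  by (auto simp: fps_agree_def fps_mult_nth intro!: sum.cong)

lemma fps_agree_sum: "(\<And>i. i \<in> A \<Longrightarrow> fps_agree K (f i) (g i)) \<Longrightarrow> fps_agree K (sum f A) (sum g A)"
  by (auto simp: fps_agree_def fps_sum_nth intro!: sum.cong)

lemma fps_agree_cancel: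
  fixes f g h :: "'a::comm_ring_1 fps"
  assumes "fps_agree K (h * f) (h * g)" "fps_nth h 0 = 1"
  shows "fps_agree K f g"
proof -
  have "fps_nth (f - g) i = 0" if "i \<le> K" for i
    using that
  proof (induction i rule: less_induct)
    case (less i)
    have "fps_nth (h * f) i = fps_nth (h * g) i"
      using assms(1) less.prems by (simp add: fps_agree_def)
    then have "0 = fps_nth (h * (f - g)) i"
      by (simp add: algebra_simps)
    also have "\<dots> = (\<Sum>j=0..i. fps_nth h j * fps_nth (f - g) (i - j))"
      by (simp only: fps_mult_nth)
    also have "\<dots> = (\<Sum>j=0..i. if j = 0 then fps_nth (f - g) i else 0)"
      using less by (intro sum.cong) (auto simp: assms(2))
    also have "\<dots> = fps_nth (f - g) i"
      by simp
    finally show ?case by simp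
  qed
  then show ?thesis by (simp add: fps_agree_def)
qed

lemma fps_agree_prodinf:
  fixes f :: "nat \<Rightarrow> 'a::idom fps"
  assumes "\<And>m. \<exists>g. f m = 1 + fps_X ^ Suc m * g"
  shows "\<forall>\<^sub>F N in sequentially. fps_agree K (\<Prod>m<N. f m) (prodinf f)"
proof -
  have "(\<lambda>N. \<Prod>m<N. f m) \<longlonglongrightarrow> prodinf f"
    using fps_convergent_prod[OF assms] by (rule has_prod_imp_tendsto')
  then have "\<forall>\<^sub>F N in sequentially. \<forall>i\<in>{..K}. fps_nth (\<Prod>m<N. f m) i = fps_nth (prodinf f) i"
    unfolding tendsto_fps_iff by (intro eventually_ball_finite) auto
  then show ?thesis by (simp add: fps_agree_def atMost_iff Ball_def)
qed

text \<open>Euler's product, the limit of \<open>qpoch\<close>; \<open>theta\<close> times this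
  factor is the series of the triple product.\<close>

definition euler_fps :: "'a::idom fps" where
  "euler_fps = prodinf (\<lambda>m. 1 - fps_X ^ Suc m)"

lemma fps_agree_euler: "\<forall>\<^sub>F N in sequentially. fps_agree K (qpoch N) (euler_fps :: 'a::idom fps)"
  unfolding qpoch_def euler_fps_def
proof (rule fps_agree_prodinf)
  show "\<exists>g. 1 - fps_X ^ Suc m = 1 + fps_X ^ Suc m * (g :: 'a fps)" for m
    by (rule exI[of _ "-1"]) simp
qed

lemma qpoch_nth_0 [simp]: "fps_nth (qpoch n) 0 = 1"
  by (induction n) (simp_all add: qpoch_Suc)

lemma euler_fps_nonzero: "(euler_fps :: 'a::idom fps) \<noteq> 0"
proof -
  obtain N where "fps_agree 0 (qpoch N) (euler_fps :: 'a fps)"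
    using fps_agree_euler[of 0] by (auto simp: eventually_sequentially)
  then have "fps_nth (euler_fps :: 'a fps) 0 = 1"
    by (simp add: fps_agree_def)
  then show ?thesis by auto
qed

lemma fps_agree_qpoch:
  assumes "K \<le> M" "K \<le> N"
  shows "fps_agree K (qpoch M) (qpoch N :: 'a::comm_ring_1 fps)"
proof -
  have "fps_agree K (qpoch (K + d)) (qpoch K :: 'a fps)" for d
  proof (induction d)
    case (Suc d)
    have "fps_agree K (1 - fps_X ^ Suc (K + d)) (1 :: 'a fps)"
      by (auto simp: fps_agree_def simp del: power_Suc)
    from fps_agree_mult[OF Suc.IH this] show ?case
      by (simp add: qpoch_Suc)
  qed simp
  then show ?thesis
    using assms by (metis fps_agree_sym fps_agree_trans le_Suc_ex)
qed

text \<open>In the limit a Gaussian binomial becomes \<open>1 / euler_fps\<close>. All of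
  \<open>qpoch k\<close>, \<open>qpoch l\<close>, \<open>qpoch n\<close>, \<open>qpoch N\<close>
  agree up to \<open>K\<close>, so one further factor \<open>qpoch N\<close> reduces the claim to
  \<open>qbin_add_qpoch\<close> and is then cancelled.\<close>

lemma fps_agree_qbin:
  assumes "K \<le> k" "K + k \<le> n" "K \<le> N"
  shows "fps_agree K (qpoch N * qbin n k) (1 :: 'a::comm_ring_1 fps)"
proof (rule fps_agree_cancel)
  obtain l where n: "n = k + l" and l: "K \<le> l"
    using assms(2) by (metis add.commute add_le_cancel_left le_add1 le_trans nat_le_iff_add)
  have "fps_agree K (qpoch N * (qpoch N * qbin n k)) (qpoch k * (qpoch l * qbin n k :: 'a fps))"
    using assms l by (intro fps_agree_mult fps_agree_qpoch) auto
  also have "qpoch k * (qpoch l * qbin n k) = (qpoch n :: 'a fps)"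
    using qbin_add_qpoch[of k l] by (simp add: n mult_ac)
  also have "fps_agree K (qpoch n :: 'a fps) (qpoch N * 1)"
    using assms by (simp add: fps_agree_qpoch)
  finally show "fps_agree K (qpoch N * (qpoch N * qbin n k)) (qpoch N * 1 :: 'a fps)" .
qed simp

section \<open>Graded sums\<close>

text \<open>The formal sum of \<open>f i * q^(d i)\<close> over a possibly infinite set. It is
  meaningful when the fibres of \<open>d\<close> are finite, which the lemmas on products and unions
  assume.\<close>

definition graded_sum :: "'i set \<Rightarrow> ('i \<Rightarrow> nat) \<Rightarrow> ('i \<Rightarrow> 'a::comm_ring_1) \<Rightarrow> 'a fps" where
  "graded_sum I d f = Abs_fps (\<lambda>k. \<Sum>i | i \<in> I \<and> d i = k. f i)"

lemma graded_sum_nth [simp]: "fps_nth (graded_sum I d f) k = (\<Sum>i | i \<in> I \<and> d i = k. f i)"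
  by (simp add: graded_sum_def)

lemma graded_sum_uminus: "graded_sum I d (\<lambda>i. - f i) = - graded_sum I d f"
  by (simp add: fps_eq_iff sum_negf)

lemma graded_sum_mult:
  assumes "\<And>k. finite {i\<in>I. d i = k}" "\<And>k. finite {j\<in>J. e j = k}"
  shows "graded_sum I d f * graded_sum J e g =
    graded_sum (I \<times> J) (\<lambda>(i, j). d i + e j) (\<lambda>(i, j). f i * g j)"
proof (rule fps_ext)
  fix n
  have "fps_nth (graded_sum I d f * graded_sum J e g) n =
      (\<Sum>k=0..n. \<Sum>(i, j)\<in>{i\<in>I. d i = k} \<times> {j\<in>J. e j = n - k}. f i * g j)"
    by (simp add: fps_mult_nth sum_product sum.cartesian_product)
  also have "\<dots> = (\<Sum>(k, i, j)\<in>Sigma {0..n} (\<lambda>k. {i\<in>I. d i = k} \<times> {j\<in>J. e j = n - k}). f i * g j)"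
    by (subst sum.Sigma) (auto simp: assms)
  also have "\<dots> = (\<Sum>(i, j) | (i, j) \<in> I \<times> J \<and> d i + e j = n. f i * g j)"
    by (rule sum.reindex_bij_witness[where i = "\<lambda>(i, j). (d i, i, j)" and j = snd]) auto
  finally show "fps_nth (graded_sum I d f * graded_sum J e g) n =
      fps_nth (graded_sum (I \<times> J) (\<lambda>(i, j). d i + e j) (\<lambda>(i, j). f i * g j)) n"
    by (simp add: case_prod_unfold mem_Times_iff)
qed

lemma graded_sum_Un:
  assumes "\<And>k. finite {i\<in>I. d i = k}" "\<And>k. finite {i\<in>J. d i = k}" "I \<inter> J = {}"
  shows "graded_sum (I \<union> J) d f = graded_sum I d f + graded_sum J d f"
proof (rule fps_ext)
  fix k
  have "{i. i \<in> I \<union> J \<and> d i = k} = {i\<in>I. d i = k} \<union> {i\<in>J. d i = k}" by auto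
  then show "fps_nth (graded_sum (I \<union> J) d f) k = fps_nth (graded_sum I d f + graded_sum J d f) k"
    using assms by (simp only: graded_sum_nth fps_add_nth) (subst sum.union_disjoint; auto)
qed

lemma graded_sum_reindex:
  assumes "bij_betw h I J"
  shows "graded_sum J d f = graded_sum I (\<lambda>i. d (h i)) (\<lambda>i. f (h i))"
proof (rule fps_ext)
  fix k
  have "bij_betw h {i\<in>I. d (h i) = k} {j\<in>J. d j = k}"
    using assms by (auto simp: bij_betw_def inj_on_def)
  from sum.reindex_bij_betw[OF this, of f]
  show "fps_nth (graded_sum J d f) k = fps_nth (graded_sum I (\<lambda>i. d (h i)) (\<lambda>i. f (h i))) k"
    by simp
qed

lemma graded_sum_cong:
  assumes "\<And>i. i \<in> I \<Longrightarrow> d i = e i" "\<And>i. i \<in> I \<Longrightarrow> f i = g i"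
  shows "graded_sum I d f = graded_sum I e g"
  by (rule fps_ext) (auto intro!: sum.cong simp: assms)

section \<open>The Jacobi triple product\<close>

definition lat_scale :: "int \<Rightarrow> 'n lat \<Rightarrow> 'n lat" where
  "lat_scale j u = Poly_Mapping.map ((*) j) u"

lemma lookup_lat_scale [simp]: "Poly_Mapping.lookup (lat_scale j u) g = j * Poly_Mapping.lookup u g"
  by (simp add: lat_scale_def Poly_Mapping.map.rep_eq when_def)

lemma lat_eq_iff: "u = v \<longleftrightarrow> (\<forall>g. Poly_Mapping.lookup u g = Poly_Mapping.lookup v g)"
  by (metis poly_mapping_eqI)

lemma lat_scale_0 [simp]: "lat_scale 0 u = 0"
  by (simp add: lat_eq_iff)

lemma expi_add: "expi (u + v) = expi u * expi v"
  by (simp add: expi_def mult_single)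

lemma expi_0 [simp]: "expi 0 = 1"
  by (simp add: expi_def)

lemma expi_power: "expi u ^ k = expi (lat_scale (int k) u)"
proof (induction k)
  case (Suc k)
  have "lat_scale (int (Suc k)) u = u + lat_scale (int k) u"
    by (simp add: lat_eq_iff lookup_add algebra_simps)
  then show ?case using Suc by (simp add: expi_add)
qed simp

definition theta_coeff :: "'n::linorder lat \<Rightarrow> int \<Rightarrow> 'n galg" where
  "theta_coeff u j = (if even j then -1 else 1) * expi (lat_scale (2 * j - 1) u)"

lemma ichoose2_le_imp:
  assumes "ichoose2 j \<le> K"
  shows "- int K - 1 \<le> j \<and> j \<le> int K + 2"
proof (rule ccontr)
  assume "\<not> ?thesis"
  then consider "j \<le> - int K - 2" | "int K + 3 \<le> j" by linarith
  then have "2 * int K + 1 \<le> j * (j - 1)"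
  proof cases
    case 1
    then have "2 * (int K + 2) \<le> (- j) * (1 - j)" by (intro mult_mono) auto
    then show ?thesis by (simp add: algebra_simps)
  next
    case 2
    then have "2 * (int K + 2) \<le> (j - 1) * j" by (intro mult_mono) auto
    then show ?thesis by (simp add: algebra_simps)
  qed
  moreover have "j * (j - 1) \<le> 2 * int K"
    using int_ichoose2[of j] assms by linarith
  ultimately show False by linarith
qed

lemma finite_ichoose2_le: "finite {j. ichoose2 j \<le> k}"
  by (rule finite_subset[of _ "{- int k - 1 .. int k + 2}"]) (use ichoose2_le_imp in force, simp)

lemma finite_ichoose2: "finite {j. ichoose2 j = k}"
  by (rule finite_subset[OF _ finite_ichoose2_le[of k]]) auto

text \<open>Take \<open>t = expi (u + u)\<close> and its inverse for \<open>s\<close> in the finite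
  triple product. As \<open>expi u - expi (- u)\<close> is \<open>- expi (- u) * (1 - t)\<close>,
  dividing by \<open>(- t) ^ N\<close> centres the sum at \<open>k = N\<close>.\<close>

lemma theta_finite:
  fixes u :: "'n::linorder lat"
  shows "fps_const (expi u - expi (- u)) * (\<Prod>m<N. theta_factor u (Suc m)) =
    (\<Sum>k\<le>2*N+1. fps_X ^ ichoose2 (int k - int N) * qbin (2*N+1) k * fps_const (theta_coeff u (int k - int N)))"
proof -
  let ?t = "fps_const (expi (u + u))" and ?s = "fps_const (expi (- (u + u)))"
  let ?e = "fps_const (- expi (- u))"
  have ts: "?t * ?s = 1" by (simp add: expi_add[symmetric])
  have e: "fps_const (expi u - expi (- u)) = ?e * (1 - ?t)"
    by (simp add: fps_const_1_eq_1[symmetric] algebra_simps expi_add[symmetric] del: fps_const_1_eq_1)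
  have "(- ?s) ^ N * (- ?t) ^ N = (1 :: 'n ser)"
    using ts by (simp add: power_mult_distrib[symmetric] mult.commute)
  then have "fps_const (expi u - expi (- u)) * (\<Prod>m<N. theta_factor u (Suc m)) =
      ?e * (- ?s) ^ N * ((- ?t) ^ N * (1 - ?t) *
        (\<Prod>m<N. (1 - fps_X ^ Suc m * ?t) * (1 - fps_X ^ Suc m * ?s)))"
    unfolding e theta_factor_def by (simp add: mult_ac del: power_Suc)
  also have "\<dots> = (\<Sum>k\<le>2*N+1. fps_X ^ ichoose2 (int k - int N) * qbin (2*N+1) k *
      (?e * (- ?s) ^ N * (- ?t) ^ k))"
    unfolding finite_triple_product[OF ts] sum_distrib_left
    by (intro sum.cong refl) (simp only: mult_ac)
  also have "\<dots> = (\<Sum>k\<le>2*N+1. fps_X ^ ichoose2 (int k - int N) * qbin (2*N+1) k *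
      fps_const (theta_coeff u (int k - int N)))"
  proof (rule sum.cong[OF refl], rule arg_cong[of _ _ "(*) _"])
    fix k
    show "?e * (- ?s) ^ N * (- ?t) ^ k = fps_const (theta_coeff u (int k - int N))"
    proof -
      have "?e * (- ?s) ^ N * (- ?t) ^ k =
          fps_const (- ((-1) ^ N * (-1) ^ k) * (expi (- u) * expi (- (u + u)) ^ N * expi (u + u) ^ k))"
        by (simp add: power_minus[of "expi _"] fps_const_power mult_ac)
      also have "expi (- u) * expi (- (u + u)) ^ N * expi (u + u) ^ k =
          expi (lat_scale (2 * (int k - int N) - 1) u)"
        unfolding expi_power expi_add[symmetric]
        by (rule arg_cong[of _ _ expi]) (simp add: lat_eq_iff lookup_add lookup_minus ring_distribs)
      also have "- ((-1) ^ N * (-1) ^ k) = (if even (int k - int N) then -1 else 1 :: 'n galg)"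
        by (simp add: power_add[symmetric] minus_one_power_iff)
      finally show ?thesis by (simp add: theta_coeff_def)
    qed
  qed
  finally show ?thesis .
qed

lemma fps_agree_theta:
  "\<forall>\<^sub>F N in sequentially.
    fps_agree K (fps_const (expi u - expi (- u)) * (\<Prod>m<N. theta_factor u (Suc m))) (theta u)"
proof -
  have "\<exists>g. theta_factor u (Suc m) = 1 + fps_X ^ Suc m * g" for m
  proof -
    let ?a = "fps_const (expi (u + u))" and ?b = "fps_const (expi (- (u + u)))"
    have "theta_factor u (Suc m) = 1 + fps_X ^ Suc m * (fps_X ^ Suc m * ?a * ?b - ?a - ?b)"
      unfolding theta_factor_def by (simp only: algebra_simps mult_1_left mult_1_right)
    then show ?thesis by blast
  qed
  from fps_agree_prodinf[OF this] show ?thesis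
    unfolding theta_def by eventually_elim (rule fps_agree_mult[OF fps_agree_refl])
qed

text \<open>Multiply the finite identity by \<open>qpoch N\<close>. Up to \<open>q^K\<close> only
  indices near \<open>k = N\<close> contribute, and there \<open>qpoch N\<close> times the Gaussian
  binomial is congruent to 1.\<close>

lemma jacobi_triple_product:
  fixes u :: "'n::linorder lat"
  shows "euler_fps * theta u = graded_sum UNIV ichoose2 (theta_coeff u)"
proof (rule fps_ext)
  fix K
  let ?p = "\<lambda>N. fps_const (expi u - expi (- u)) * (\<Prod>m<N. theta_factor u (Suc m))"
  \<comment> \<open>With \<open>N\<close> at least \<open>2 * K + 3\<close>, every \<open>j\<close>
    with \<open>ichoose2 j\<close> at most \<open>K\<close> occurs as \<open>k - N\<close>, and both
    \<open>k\<close> and \<open>2*N+1 - k\<close> are at least \<open>K\<close>.\<close>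
  from fps_agree_theta[of K u] fps_agree_euler[of K, where 'a = "'n galg"]
    eventually_ge_at_top[of "2 * K + 3"]
  have "\<forall>\<^sub>F N in sequentially. 2 * K + 3 \<le> N \<and> fps_agree K (qpoch N) (euler_fps :: 'n ser) \<and>
      fps_agree K (?p N) (theta u)"
    by eventually_elim simp
  then obtain N where N: "2 * K + 3 \<le> N" "fps_agree K (qpoch N) (euler_fps :: 'n ser)"
      "fps_agree K (?p N) (theta u)"
    unfolding eventually_sequentially by blast
  let ?c = "theta_coeff u"
  have "fps_agree K (euler_fps * theta u) (qpoch N * ?p N)"
    using N by (intro fps_agree_mult) (auto intro: fps_agree_sym)
  also have "\<dots> = (\<Sum>k\<le>2*N+1. fps_X ^ ichoose2 (int k - int N) * (qpoch N * qbin (2*N+1) k) *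
      fps_const (?c (int k - int N)))"
    unfolding theta_finite sum_distrib_left by (intro sum.cong refl) (simp only: mult_ac)
  also have "fps_agree K \<dots> (\<Sum>k\<le>2*N+1. fps_X ^ ichoose2 (int k - int N) * fps_const (?c (int k - int N)))"
  proof (rule fps_agree_sum)
    fix k assume k: "k \<in> {..2*N+1}"
    show "fps_agree K (fps_X ^ ichoose2 (int k - int N) * (qpoch N * qbin (2*N+1) k) *
        fps_const (?c (int k - int N))) (fps_X ^ ichoose2 (int k - int N) * fps_const (?c (int k - int N)))"
    proof (cases "ichoose2 (int k - int N) \<le> K")
      case True
      then have "K \<le> k" "K + k \<le> 2*N+1" "K \<le> N"
        using ichoose2_le_imp[OF True] N(1) by linarith+
      from fps_agree_mult[OF fps_agree_mult[OF fps_agree_refl fps_agree_qbin[OF this]] fps_agree_refl]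
      show ?thesis by (metis mult_1_right)
    next
      case False
      then show ?thesis
        by (auto simp: fps_agree_def fps_X_power_mult_nth mult.assoc)
    qed
  qed
  finally have "fps_nth (euler_fps * theta u) K =
      (\<Sum>k\<le>2*N+1. if ichoose2 (int k - int N) = K then ?c (int k - int N) else 0)"
    by (auto simp: fps_agree_def fps_sum_nth fps_X_power_mult_nth intro!: sum.cong)
  also have "\<dots> = (\<Sum>k | k \<le> 2*N+1 \<and> ichoose2 (int k - int N) = K. ?c (int k - int N))"
    by (simp only: sum.inter_filter[symmetric] finite_atMost atMost_iff)
  also have "\<dots> = (\<Sum>j | ichoose2 j = K. ?c j)"
  proof (rule sum.reindex_bij_witness[where i = "\<lambda>j. nat (j + int N)" and j = "\<lambda>k. int k - int N"])
    fix j assume "j \<in> {j. ichoose2 j = K}"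
    then have "- int K - 1 \<le> j \<and> j \<le> int K + 2" using ichoose2_le_imp[of j K] by simp
    then have "0 \<le> j + int N" "j \<le> int N + 1" using N(1) by linarith+
    then show "int (nat (j + int N)) - int N = j"
      "nat (j + int N) \<in> {k. k \<le> 2*N+1 \<and> ichoose2 (int k - int N) = K}"
      using \<open>j \<in> _\<close> by auto
  qed auto
  finally show "fps_nth (euler_fps * theta u) K = fps_nth (graded_sum UNIV ichoose2 ?c) K"
    by simp
qed

section \<open>The three-term identity\<close>

text \<open>With \<open>theta_odd\<close>, the two level-two theta functions: sums over the even,
  resp. odd, multiples \<open>n\<close> of \<open>v\<close>, with \<open>q\<close> raised to
  \<open>n^2 / 4\<close>, resp. \<open>(n^2 - 1) / 4\<close>.\<close>

definition theta_even :: "'n::linorder lat \<Rightarrow> 'n ser" where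
  "theta_even v = graded_sum UNIV (\<lambda>k. nat (k * k)) (\<lambda>k. expi (lat_scale (2 * k) v))"

definition theta_odd :: "'n::linorder lat \<Rightarrow> 'n ser" where
  "theta_odd v = graded_sum UNIV (\<lambda>k. nat (k * k + k)) (\<lambda>k. expi (lat_scale (2 * k + 1) v))"

text \<open>Coordinates in which \<open>(2i-1) p + (2j-1) r\<close> becomes
  \<open>2k (p+r) + (2l+1) (p-r)\<close>; for even \<open>i + j\<close>, the next lemma gives the
  same with the two parities exchanged.\<close>

lemma bij_betw_odd_sum:
  "bij_betw (\<lambda>(k, l). (k + l + 1, k - l)) (UNIV \<times> UNIV) {(i :: int, j). odd (i + j)}"
proof (rule bij_betw_imageI)
  show "(\<lambda>(k, l). (k + l + 1, k - l)) ` (UNIV \<times> UNIV) = {(i :: int, j). odd (i + j)}"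
  proof safe
    fix i j :: int assume "odd (i + j)"
    then obtain q where "i + j = 2 * q + 1" by (elim oddE)
    then show "(i, j) \<in> (\<lambda>(k, l). (k + l + 1, k - l)) ` (UNIV \<times> UNIV)"
      by (intro image_eqI[of _ _ "(q, q - j)"]) auto
  qed auto
qed (auto simp: inj_on_def)

lemma bij_betw_even_sum:
  "bij_betw (\<lambda>(l, k). (l + k + 1, l - k + 1)) (UNIV \<times> UNIV) {(i :: int, j). even (i + j)}"
proof (rule bij_betw_imageI)
  show "(\<lambda>(l, k). (l + k + 1, l - k + 1)) ` (UNIV \<times> UNIV) = {(i :: int, j). even (i + j)}"
  proof safe
    fix i j :: int assume "even (i + j)"
    then obtain q where "i + j = 2 * q" by (elim evenE)
    then show "(i, j) \<in> (\<lambda>(l, k). (l + k + 1, l - k + 1)) ` (UNIV \<times> UNIV)"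
      by (intro image_eqI[of _ _ "(q - 1, q - j)"]) auto
  qed auto
qed (auto simp: inj_on_def)

text \<open>Multiply two Jacobi expansions and split the index pairs by the parity of
  \<open>i + j\<close>. Each half factors in the new coordinates, and the sign of a term is minus
  exactly for odd \<open>i + j\<close>.\<close>

lemma theta_mult_theta:
  fixes p r :: "'n::linorder lat"
  shows "euler_fps ^ 2 * (theta p * theta r) =
    theta_odd (p + r) * theta_even (p - r) - theta_even (p + r) * theta_odd (p - r)"
proof -
  define d :: "int \<times> int \<Rightarrow> nat" where "d = (\<lambda>(i, j). ichoose2 i + ichoose2 j)"
  define f :: "int \<times> int \<Rightarrow> 'n galg" where "f = (\<lambda>(i, j). theta_coeff p i * theta_coeff r j)"
  have pronic: "0 \<le> k * k + k" for k :: int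
  proof -
    have "0 \<le> k * (k + 1)" by (auto simp: zero_le_mult_iff)
    then show ?thesis by (simp add: algebra_simps)
  qed
  have fin_sq: "finite {k. nat (k * k) = n}" for n
  proof (rule finite_subset)
    show "{k. nat (k * k) = n} \<subseteq> {- int n .. int n}"
    proof
      fix k assume "k \<in> {k. nat (k * k) = n}"
      then have "\<bar>k\<bar> * \<bar>k\<bar> = int n" by auto
      then have "\<bar>k\<bar> \<le> int n" using mult_left_mono[of 1 "\<bar>k\<bar>" "\<bar>k\<bar>"] by (cases "k = 0") auto
      then show "k \<in> {- int n .. int n}" by auto
    qed
  qed simp
  have fin_pronic: "finite {k. nat (k * k + k) = n}" for n
  proof (rule finite_subset)
    have "k * k + k = (k + 1) * (k + 1 - 1)" for k :: int by (simp add: algebra_simps)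
    then have "nat (k * k + k) = 2 * ichoose2 (k + 1)" for k
      using int_ichoose2[of "k + 1"] by (metis nat_int of_nat_mult of_nat_numeral)
    then show "{k. nat (k * k + k) = n} \<subseteq> (\<lambda>j. j - 1) ` {j. ichoose2 j \<le> n}"
      by (force simp: image_iff intro: exI[of _ "_ + 1"])
  qed (simp add: finite_ichoose2_le)
  have fin: "finite {x. x \<in> I \<and> d x = n}" for I n
    by (rule finite_subset[OF _ finite_cartesian_product[OF finite_ichoose2_le[of n] finite_ichoose2_le[of n]]])
      (auto simp: d_def)
  have "euler_fps ^ 2 * (theta p * theta r) = (euler_fps * theta p) * (euler_fps * theta r)"
    by (simp add: power2_eq_square mult_ac)
  also have "\<dots> = graded_sum (UNIV \<times> UNIV) d f"
    unfolding jacobi_triple_product d_def f_def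
    by (rule graded_sum_mult) (simp_all add: finite_ichoose2)
  also have "UNIV \<times> UNIV = {(i, j). odd (i + j)} \<union> {(i :: int, j :: int). even (i + j)}"
    by auto
  also have "graded_sum \<dots> d f =
      graded_sum {(i, j). odd (i + j)} d f + graded_sum {(i, j). even (i + j)} d f"
    by (intro graded_sum_Un fin) auto
  also have "graded_sum {(i, j). odd (i + j)} d f = - (theta_even (p + r) * theta_odd (p - r))"
  proof -
    have "graded_sum {(i, j). odd (i + j)} d f =
        graded_sum (UNIV \<times> UNIV) (\<lambda>x. d (case x of (k, l) \<Rightarrow> (k + l + 1, k - l)))
          (\<lambda>x. f (case x of (k, l) \<Rightarrow> (k + l + 1, k - l)))"
      by (rule graded_sum_reindex[OF bij_betw_odd_sum])
    also have "\<dots> = graded_sum (UNIV \<times> UNIV) (\<lambda>(k, l). nat (k * k) + nat (l * l + l))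
        (\<lambda>x. - (case x of (k, l) \<Rightarrow> expi (lat_scale (2 * k) (p + r)) * expi (lat_scale (2 * l + 1) (p - r))))"
    proof (rule graded_sum_cong; clarsimp)
      fix k l :: int
      have "2 * (int (ichoose2 (k + l + 1)) + int (ichoose2 (k - l))) = 2 * (k * k + (l * l + l))"
        by (simp only: distrib_left int_ichoose2) (simp add: algebra_simps)
      then show "d (k + l + 1, k - l) = nat (k * k) + nat (l * l + l)"
        unfolding d_def prod.case
        by (intro of_nat_eq_iff[where 'a = int, THEN iffD1]) (simp add: pronic)
      show "f (k + l + 1, k - l) = - (expi (lat_scale (2 * k) (p + r)) * expi (lat_scale (2 * l + 1) (p - r)))"
      proof -
        have "lat_scale (2 * (k + l + 1) - 1) p + lat_scale (2 * (k - l) - 1) r =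
            lat_scale (2 * k) (p + r) + lat_scale (2 * l + 1) (p - r)"
          by (simp add: lat_eq_iff lookup_add lookup_minus algebra_simps)
        moreover have "even (k + l + 1) \<longleftrightarrow> odd (k - l)" by auto
        ultimately show ?thesis
          by (cases "even (k - l)") (simp_all add: f_def theta_coeff_def expi_add[symmetric] del: even_add even_diff)
      qed
    qed
    also have "\<dots> = - (theta_even (p + r) * theta_odd (p - r))"
      unfolding theta_even_def theta_odd_def graded_sum_uminus
      by (subst graded_sum_mult) (simp_all add: fin_sq fin_pronic)
    finally show ?thesis .
  qed
  also have "graded_sum {(i, j). even (i + j)} d f = theta_odd (p + r) * theta_even (p - r)"
  proof -
    have "graded_sum {(i, j). even (i + j)} d f =
        graded_sum (UNIV \<times> UNIV) (\<lambda>x. d (case x of (l, k) \<Rightarrow> (l + k + 1, l - k + 1)))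
          (\<lambda>x. f (case x of (l, k) \<Rightarrow> (l + k + 1, l - k + 1)))"
      by (rule graded_sum_reindex[OF bij_betw_even_sum])
    also have "\<dots> = graded_sum (UNIV \<times> UNIV) (\<lambda>(l, k). nat (l * l + l) + nat (k * k))
        (\<lambda>(l, k). expi (lat_scale (2 * l + 1) (p + r)) * expi (lat_scale (2 * k) (p - r)))"
    proof (rule graded_sum_cong; clarsimp)
      fix k l :: int
      have "2 * (int (ichoose2 (l + k + 1)) + int (ichoose2 (l - k + 1))) = 2 * (k * k + (l * l + l))"
        by (simp only: distrib_left int_ichoose2) (simp add: algebra_simps)
      then show "d (l + k + 1, l - k + 1) = nat (l * l + l) + nat (k * k)"
        unfolding d_def prod.case
        by (intro of_nat_eq_iff[where 'a = int, THEN iffD1]) (simp add: pronic)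
      show "f (l + k + 1, l - k + 1) = expi (lat_scale (2 * l + 1) (p + r)) * expi (lat_scale (2 * k) (p - r))"
      proof -
        have "lat_scale (2 * (l + k + 1) - 1) p + lat_scale (2 * (l - k + 1) - 1) r =
            lat_scale (2 * l + 1) (p + r) + lat_scale (2 * k) (p - r)"
          by (simp add: lat_eq_iff lookup_add lookup_minus algebra_simps)
        moreover have "even (l + k + 1) \<longleftrightarrow> even (l - k + 1)" by auto
        ultimately show ?thesis
          by (cases "even (l - k + 1)") (simp_all add: f_def theta_coeff_def expi_add[symmetric] del: even_add even_diff)
      qed
    qed
    also have "\<dots> = theta_odd (p + r) * theta_even (p - r)"
      unfolding theta_even_def theta_odd_def
      by (subst graded_sum_mult) (simp_all add: fin_sq fin_pronic)
    finally show ?thesis .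
  qed
  finally show ?thesis by simp
qed

text \<open>Up to \<open>euler_fps ^ 4\<close>, this is the Pluecker relation for the \<open>2 \<times> 2\<close> minors of the matrix
  with columns \<open>(theta_odd v, theta_even v)\<close>, \<open>v = m, m - 2a, m - 2b, m - 2c\<close>.\<close>

lemma theta_three_term:
  "theta (m - a) * theta a * (theta (m - b - c) * theta (c - b))
    - theta (m - b) * theta b * (theta (m - a - c) * theta (c - a))
    + theta (m - c) * theta c * (theta (m - a - b) * theta (b - a)) = 0"
  (is "?l = 0")
proof -
  define D where "D u v = theta_odd u * theta_even v - theta_even u * theta_odd v" for u v :: "'a lat"
  have D: "euler_fps ^ 2 * (theta p * theta r) = D (p + r) (p - r)" for p r :: "'a lat"
    by (simp add: D_def theta_mult_theta)
  have "euler_fps ^ 4 * ?l =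
      (euler_fps ^ 2 * (theta (m - a) * theta a)) * (euler_fps ^ 2 * (theta (m - b - c) * theta (c - b)))
      - (euler_fps ^ 2 * (theta (m - b) * theta b)) * (euler_fps ^ 2 * (theta (m - a - c) * theta (c - a)))
      + (euler_fps ^ 2 * (theta (m - c) * theta c)) * (euler_fps ^ 2 * (theta (m - a - b) * theta (b - a)))"
    by (simp add: power2_eq_square power4_eq_xxxx algebra_simps)
  also have "\<dots> = D m (m - (a + a)) * D (m - (b + b)) (m - (c + c))
      - D m (m - (b + b)) * D (m - (a + a)) (m - (c + c))
      + D m (m - (c + c)) * D (m - (a + a)) (m - (b + b))"
    unfolding D by (simp add: algebra_simps)
  also have "\<dots> = 0"
    by (simp add: D_def algebra_simps)
  finally show ?thesis
    by (simp add: euler_fps_nonzero)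
qed

section \<open>Oddness, nonvanishing and equivariance of theta\<close>

lemma theta_minus: "theta (- u) = - theta u"
proof -
  have "theta_factor (- u) = theta_factor u"
    by (rule ext) (simp add: theta_factor_def mult.commute)
  then show ?thesis
    unfolding theta_def by (simp add: fps_const_sub[symmetric] algebra_simps del: fps_const_sub)
qed

text \<open>The constant term is \<open>expi u - expi (- u)\<close>, which vanishes only if
  \<open>u = - u\<close>; the lattice has no 2-torsion.\<close>

lemma theta_nonzero: "u \<noteq> 0 \<Longrightarrow> theta u \<noteq> 0"
proof
  assume u: "u \<noteq> 0" and theta: "theta u = 0"
  obtain N where "fps_agree 0 (fps_const (expi u - expi (- u)) * (\<Prod>m<N. theta_factor u (Suc m))) (theta u)"
    using fps_agree_theta[of 0 u] by (auto simp: eventually_sequentially)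
  moreover have "fps_nth (\<Prod>m<N. theta_factor u (Suc m)) 0 = 1"
    by (induction N) (simp_all add: theta_factor_def)
  ultimately have "expi u - expi (- u) = 0"
    by (simp add: theta fps_agree_def)
  then have "Poly_Mapping.lookup (expi u) u = Poly_Mapping.lookup (expi (- u)) u"
    by simp
  then have "- u = u"
    by (auto simp: expi_def lookup_single when_def split: if_splits)
  then have "u = 0"
    by (auto simp: lat_eq_iff)
  with u show False ..
qed

lemma act_galg_diff: "act_galg w v (x - y) = act_galg w v x - act_galg w v y"
  using act_galg_add[of w v "x - y" y] by (simp add: algebra_simps)

lemma act_ser_diff: "act_ser w v (f - g) = act_ser w v f - act_ser w v g"
  using act_ser_add[of w v "f - g" g] by (simp add: algebra_simps)

lemma act_lat_minus: "act_lat w v (- x) = - act_lat w v x"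
  using act_lat_add[of w v "- x" x] act_lat_add[of w v 0 0] by (simp add: eq_neg_iff_add_eq_0)

lemma act_lat_diff: "act_lat w v (x - y) = act_lat w v x - act_lat w v y"
  using act_lat_add[of w v x "- y"] by (simp add: act_lat_minus)

lemma act_lat_gens [simp]:
  "act_lat w v (zvar i) = zvar (w \<langle>$\<rangle> i)"
  "act_lat w v (lvar i) = lvar (v \<langle>$\<rangle> i)"
  "act_lat w v hbar = hbar"
  by (simp_all add: act_lat_def zvar_def lvar_def hbar_def)

lemma act_galg_expi: "act_galg w v (expi u) = expi (act_lat w v u)"
  by (simp add: act_galg_def expi_def)

lemma act_ser_const: "act_ser w v (fps_const c) = fps_const (act_galg w v c)"
  by (simp add: act_ser_def fps_eq_iff act_galg_0)

lemma act_ser_X: "act_ser w v fps_X = fps_X"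
  by (simp add: act_ser_def fps_eq_iff fps_X_def act_galg_0 act_galg_one)

lemma act_ser_power: "act_ser w v (f ^ k) = act_ser w v f ^ k"
  by (induction k) (simp_all add: act_ser_times)

lemma act_ser_prod: "act_ser w v (prod f A) = (\<Prod>i\<in>A. act_ser w v (f i))"
  by (induction A rule: infinite_finite_induct) (simp_all add: act_ser_times)

text \<open>The action is defined on coefficients, so it can be computed on a partial product that
  already has the right coefficients up to \<open>K\<close>.\<close>

lemma act_ser_theta: "act_ser w v (theta u) = theta (act_lat w v u)"
proof (rule fps_ext)
  fix K
  let ?p = "\<lambda>N u. fps_const (expi u - expi (- u)) * (\<Prod>m<N. theta_factor u (Suc m))"
  have "\<forall>\<^sub>F N in sequentially. fps_agree K (?p N u) (theta u) \<and>
      fps_agree K (?p N (act_lat w v u)) (theta (act_lat w v u))"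
    using fps_agree_theta[of K u] fps_agree_theta[of K "act_lat w v u"] by eventually_elim simp
  then obtain N where N: "fps_agree K (?p N u) (theta u)"
      "fps_agree K (?p N (act_lat w v u)) (theta (act_lat w v u))"
    unfolding eventually_sequentially by blast
  have "act_ser w v (theta_factor u m) = theta_factor (act_lat w v u) m" for m
    by (simp add: theta_factor_def act_ser_times act_ser_diff act_ser_power act_ser_X act_ser_const
        act_galg_expi act_lat_minus act_lat_diff act_lat_add)
  then have "act_ser w v (?p N u) = ?p N (act_lat w v u)"
    by (simp add: act_ser_times act_ser_const act_galg_diff act_galg_expi act_lat_minus act_ser_prod)
  moreover have "fps_nth (act_ser w v (?p N u)) K = fps_nth (act_ser w v (theta u)) K"
    using N(1) by (simp add: act_ser_def fps_agree_def)
  ultimately show "fps_nth (act_ser w v (theta u)) K = fps_nth (theta (act_lat w v u)) K"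
    using N(2) by (simp add: fps_agree_def)
qed

section \<open>Identities between the weights\<close>

definition th :: "'n::linorder lat \<Rightarrow> 'n efield" where
  "th u = Fract (theta u) 1"

lemma th_minus: "th (- u) = - th u"
  by (simp add: th_def theta_minus)

lemma th_nonzero: "u \<noteq> 0 \<Longrightarrow> th u \<noteq> 0"
  using theta_nonzero[of u] by (simp add: th_def Zero_fract_def eq_fract)

lemma th_diff_swap: "th (x - y) = - th (y - x)"
  using th_minus[of "y - x"] by simp

lemma th_three_term:
  "th (m - a) * th a * (th (m - b - c) * th (c - b))
    - th (m - b) * th b * (th (m - a - c) * th (c - a))
    + th (m - c) * th c * (th (m - a - b) * th (b - a)) = 0"
  using theta_three_term[of m a b c] by (simp add: th_def Zero_fract_def)

lemma Pfun_eq: "Pfun x y = th (x - y) * th hbar / (th (y + hbar) * th x)"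
  by (simp add: Pfun_def th_def)

lemma Qfun_eq: "Qfun x y = th (x + hbar) * th y / (th (y + hbar) * th x)"
  by (simp add: Qfun_def th_def)

lemma act_Pfun: "act w v (Pfun x y) = Pfun (act_lat w v x) (act_lat w v y)"
  by (simp add: Pfun_def act_Fract act_ser_times act_ser_theta act_lat_diff act_lat_add)

lemma act_Qfun: "act w v (Qfun x y) = Qfun (act_lat w v x) (act_lat w v y)"
  by (simp add: Qfun_def act_Fract act_ser_times act_ser_theta act_lat_add)

text \<open>The three-term identity at \<open>m = 0\<close>, rewritten with \<open>th\<close> odd.
  It serves \<open>PQ_square\<close> and, together with \<open>th_cubic\<close>, the braid
  relation.\<close>

lemma th_weierstrass:
  "th (x - y) * th (x + y) * th h ^ 2 + th (h + x) * th (h - x) * th y ^ 2 = th (h + y) * th (h - y) * th x ^ 2"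
proof -
  have "0 - h = - h" "0 - y - x = - (x + y)" "0 - y = - y" "0 - h - x = - (h + x)" "x - h = - (h - x)"
    "0 - x = - x" "0 - h - y = - (h + y)" "y - h = - (h - y)"
    by (simp_all add: algebra_simps)
  then have "- th h * th h * (- th (x + y) * th (x - y)) - - th y * th y * (- th (h + x) * - th (h - x))
      + - th x * th x * (- th (h + y) * - th (h - y)) = 0"
    using th_three_term[of 0 h y x] by (simp only: th_minus)
  then show ?thesis by algebra
qed

text \<open>The specialization \<open>m = y - a\<close> at \<open>b\<close>, \<open>y\<close>,
  \<open>- x\<close>; it is what remains of \<open>PQ_fay\<close> after clearing
  denominators.\<close>

lemma th_fay:
  "th (x - a) * th (y - (a + b)) * th (x + y) * th b + th (x + y - (a + b)) * th (x + b) * th a * th y =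
    th (y - b) * th (x + y - a) * th x * th (a + b)"
proof -
  have "y - a - b = y - (a + b)" "y - a - y = - a" "- x - y = - (x + y)" "- x - b = - (x + b)"
    "y - a - - x = x + y - a" "- a - - x = x - a" "y - (a + b) - - x = x + y - (a + b)"
    "y - (a + b) - y = - (a + b)"
    by (simp_all add: algebra_simps)
  then have "th (y - (a + b)) * th b * (th (x - a) * - th (x + y))
      - - th a * th y * (th (x + y - (a + b)) * - th (x + b))
      + th (x + y - a) * - th x * (- th (a + b) * th (y - b)) = 0"
    using th_three_term[of "y - a" b y "- x"]
    by (simp only: th_minus)
  then show ?thesis by algebra
qed

text \<open>The specialization \<open>m = a + b\<close> at \<open>y\<close>, \<open>b\<close>,
  \<open>x\<close>; it compares the two products of three \<open>Pfun\<close> in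
  \<open>PQ_cubic\<close>.\<close>

lemma th_cubic:
  "th (x - a) * th (x - b) * th (y - (a + b)) * th y - th (y - a) * th (y - b) * th (x - (a + b)) * th x =
    - (th a * th b * th (x + y - (a + b)) * th (x - y))"
proof -
  have "a + b - y = - (y - (a + b))" "a + b - b - x = - (x - a)" "a + b - b = a"
    "a + b - y - x = - (x + y - (a + b))" "a + b - x = - (x - (a + b))" "a + b - y - b = - (y - a)"
    "b - y = - (y - b)"
    by (simp_all add: algebra_simps)
  then have "- th (y - (a + b)) * th y * (- th (x - a) * th (x - b))
      - th a * th b * (- th (x + y - (a + b)) * th (x - y))
      + - th (x - (a + b)) * th x * (- th (y - a) * - th (y - b)) = 0"
    using th_three_term[of "a + b" y b x] by (metis th_minus)
  then show ?thesis by algebra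
qed

text \<open>The coefficient of \<open>del 1\<close> in \<open>Tsimple i * Tsimple i\<close>, with
  \<open>x\<close> and \<open>a\<close> differences of the \<open>z\<close> and \<lambda> variables;
  \<open>PQ_cross\<close> is the coefficient of \<open>del (simple i)\<close>.\<close>

lemma PQ_square:
  assumes "x \<noteq> 0" "a + hbar \<noteq> 0" "hbar - a \<noteq> 0"
  shows "Pfun x a * Pfun x (- a) + Qfun x a * Qfun (- x) (- a) = 1"
proof -
  have "th (x - a) * th (x + a) * th hbar ^ 2 + th (x + hbar) * th (hbar - x) * th a ^ 2 =
      th (a + hbar) * th (hbar - a) * th x ^ 2"
    using th_weierstrass[of x a hbar] by (simp add: add.commute)
  then show ?thesis
    using assms[THEN th_nonzero] by (simp add: Pfun_eq Qfun_eq th_minus field_simps power2_eq_square)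
qed

lemma PQ_cross:
  assumes "x \<noteq> 0" "a + hbar \<noteq> 0" "hbar - a \<noteq> 0"
  shows "Pfun x a * Qfun x (- a) + Qfun x a * Pfun (- x) (- a) = 0"
proof -
  have "th (- x - - a) = - th (x - a)" using th_minus[of "x - a"] by simp
  then show ?thesis
    using assms[THEN th_nonzero] by (simp add: Pfun_eq Qfun_eq th_minus field_simps)
qed

text \<open>\<open>Qfun x a\<close> is a quotient \<open>f x / f a\<close> with
  \<open>f x = th (x + hbar) / th x\<close>; this is also behind
  \<open>Qfun x y * Qfun y x = 1\<close> below.\<close>

lemma QQ_swap: "Qfun x a * Qfun y b = Qfun x b * Qfun y a"
  by (simp add: Qfun_eq mult_ac)

lemma QP_inverse:
  assumes "x \<noteq> 0" "y \<noteq> 0" "x + hbar \<noteq> 0" "y + hbar \<noteq> 0"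
  shows "Pfun x y + Qfun x y * Pfun y x = 0" "Qfun x y * Qfun y x = 1"
  using assms[THEN th_nonzero] th_diff_swap[of y x]
  by (simp_all add: Pfun_eq Qfun_eq field_simps)

section \<open>Two identities behind the braid relation\<close>

context
  fixes x y a b :: "'n::linorder lat"
  assumes x: "x \<noteq> 0" and y: "y \<noteq> 0" and xy: "x + y \<noteq> 0"
    and a: "a + hbar \<noteq> 0" and b: "b + hbar \<noteq> 0" and ab: "a + b + hbar \<noteq> 0"
begin

private lemma nz: "th x \<noteq> 0" "th y \<noteq> 0" "th (x + y) \<noteq> 0" "th (a + hbar) \<noteq> 0" "th (b + hbar) \<noteq> 0"
    "th (a + b + hbar) \<noteq> 0"
  using x y xy a b ab by (simp_all add: th_nonzero)

text \<open>The coefficient of \<open>del (simple i)\<close> on the two sides of the braid relation;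
  over the common denominator \<open>D\<close> it becomes \<open>th_fay\<close>.\<close>

lemma PQ_fay:
  "Pfun x a * Pfun y (a + b) * Qfun x b + Qfun x a * Pfun (x + y) (a + b) * Pfun (- x) b =
    Pfun y b * Qfun x (a + b) * Pfun (x + y) a"
proof -
  have "th (- x - b) = - th (x + b)" using th_minus[of "x + b"] by simp
  moreover define D where "D = th (a + hbar) * th (b + hbar) * th (a + b + hbar) * th x ^ 2 * th y * th (x + y)"
  moreover have "D \<noteq> 0" using nz by (simp add: D_def)
  ultimately have "(Pfun x a * Pfun y (a + b) * Qfun x b + Qfun x a * Pfun (x + y) (a + b) * Pfun (- x) b) * D =
     th hbar ^ 2 * th (x + hbar) *
      (th (x - a) * th (y - (a + b)) * th (x + y) * th b + th (x + y - (a + b)) * th (x + b) * th a * th y)"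
    using nz by (simp add: Pfun_eq Qfun_eq th_minus D_def field_simps power2_eq_square)
  also have "\<dots> = Pfun y b * Qfun x (a + b) * Pfun (x + y) a * D"
    unfolding th_fay using nz by (simp add: Pfun_eq Qfun_eq D_def field_simps power2_eq_square)
  finally show ?thesis using \<open>D \<noteq> 0\<close> by simp
qed

text \<open>The coefficient of \<open>del 1\<close>. Over the common denominator \<open>D\<close>,
  the products of three \<open>Pfun\<close> differ by \<open>th_cubic\<close>, the mixed terms by
  \<open>th_weierstrass\<close>, and the two differences cancel.\<close>

lemma PQ_cubic:
  "Pfun x a * Pfun y (a + b) * Pfun x b + Qfun x a * Pfun (x + y) (a + b) * Qfun (- x) b =
    Pfun y b * Pfun x (a + b) * Pfun y a + Qfun y b * Pfun (x + y) (a + b) * Qfun (- y) a"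
proof -
  define D where "D = th (a + hbar) * th (b + hbar) * th (a + b + hbar) * th x ^ 2 * th y ^ 2 * th (x + y)"
  define S where "S = th a * th b * th (x + y - (a + b))"
  have D: "D \<noteq> 0" using nz by (simp add: D_def)
  have "Pfun x a * Pfun y (a + b) * Pfun x b * D =
      th hbar ^ 3 * th (x + y) * (th (x - a) * th (x - b) * th (y - (a + b)) * th y)"
    "Pfun y b * Pfun x (a + b) * Pfun y a * D =
      th hbar ^ 3 * th (x + y) * (th (y - a) * th (y - b) * th (x - (a + b)) * th x)"
    "Qfun x a * Pfun (x + y) (a + b) * Qfun (- x) b * D =
      - (th hbar * S * (th (hbar + x) * th (hbar - x) * th y ^ 2))"
    "Qfun y b * Pfun (x + y) (a + b) * Qfun (- y) a * D =
      - (th hbar * S * (th (hbar + y) * th (hbar - y) * th x ^ 2))"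
    using nz by (simp_all add: Pfun_eq Qfun_eq th_minus D_def S_def power2_eq_square power3_eq_cube
        divide_simps add.commute[of hbar])
  moreover have "th hbar ^ 3 * th (x + y) * (th (x - a) * th (x - b) * th (y - (a + b)) * th y) +
      - (th hbar * S * (th (hbar + x) * th (hbar - x) * th y ^ 2)) =
      th hbar ^ 3 * th (x + y) * (th (y - a) * th (y - b) * th (x - (a + b)) * th x) +
      - (th hbar * S * (th (hbar + y) * th (hbar - y) * th x ^ 2))"
    using th_cubic[of x a b y] th_weierstrass[of x y hbar] unfolding S_def[symmetric] by algebra
  ultimately have "(Pfun x a * Pfun y (a + b) * Pfun x b + Qfun x a * Pfun (x + y) (a + b) * Qfun (- x) b) * D =
      (Pfun y b * Pfun x (a + b) * Pfun y a + Qfun y b * Pfun (x + y) (a + b) * Qfun (- y) a) * D"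
    by (simp only: distrib_right)
  then show ?thesis using D by (simp only: mult_cancel_right) simp
qed

end

section \<open>Simple transpositions\<close>

lemma nxt_greater: "\<exists>k. i < k \<Longrightarrow> i < nxt i"
  unfolding nxt_def using Min_in[of "{k. i < k}"] by auto

lemma nxt_le: "i < k \<Longrightarrow> nxt i \<le> k"
  unfolding nxt_def by (rule Min_le) auto

lemma apply_swap: "\<langle>a \<leftrightarrow> b\<rangle> \<langle>$\<rangle> c = (if c = a then b else if c = b then a else c)"
  by transfer (simp add: Transposition.transpose_def)

lemma simple_apply: "simple i \<langle>$\<rangle> k = (if k = i then nxt i else if k = nxt i then i else k)"
  by (simp add: simple_def apply_swap)

lemma simple_square [simp]: "simple i * simple i = 1"
  by (rule perm_eqI) (simp add: apply_times simple_apply)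

lemma simple_cancel [simp]: "simple i * (simple i * w) = w"
  by (simp flip: mult.assoc)

lemma inverse_simple [simp]: "inverse (simple i) = simple i"
  by (simp add: simple_def)

lemma inverse_apply_apply [simp]: "inverse w \<langle>$\<rangle> (w \<langle>$\<rangle> a) = a" "w \<langle>$\<rangle> (inverse w \<langle>$\<rangle> a) = a"
proof -
  have "(inverse w * w) \<langle>$\<rangle> a = a" "(w * inverse w) \<langle>$\<rangle> a = a"
    by simp_all
  then show "inverse w \<langle>$\<rangle> (w \<langle>$\<rangle> a) = a" "w \<langle>$\<rangle> (inverse w \<langle>$\<rangle> a) = a"
    by (simp_all only: apply_times o_apply)
qed

lemma apply_eq_iff [simp]: "w \<langle>$\<rangle> a = w \<langle>$\<rangle> b \<longleftrightarrow> a = b"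
  by (metis inverse_apply_apply(1))

text \<open>Bruhat steps multiply by transpositions on the right, words grow on the left;
  conjugation by \<open>w\<close> passes between the two.\<close>

lemma simple_mult_eq: "simple i * w = w * \<langle>(inverse w \<langle>$\<rangle> i) \<leftrightarrow> (inverse w \<langle>$\<rangle> (nxt i))\<rangle>"
proof (rule perm_eqI)
  fix a
  have "w \<langle>$\<rangle> a = b \<longleftrightarrow> a = inverse w \<langle>$\<rangle> b" for b by auto
  then show "(simple i * w) \<langle>$\<rangle> a = (w * \<langle>(inverse w \<langle>$\<rangle> i) \<leftrightarrow> (inverse w \<langle>$\<rangle> (nxt i))\<rangle>) \<langle>$\<rangle> a"
    by (simp add: apply_times simple_apply apply_swap)
qed

section \<open>Inversions\<close>

definition inversions :: "'n::{finite,linorder} perm \<Rightarrow> ('n \<times> 'n) set" where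
  "inversions w = {(a, b). a < b \<and> w \<langle>$\<rangle> b < w \<langle>$\<rangle> a}"

text \<open>The inversions of \<open>w\<close> inject into those of \<open>w \<langle>a \<leftrightarrow> b\<rangle>\<close>, missing \<open>(a, b)\<close>: transpose both
  entries if this keeps them in order, and otherwise leave them alone.\<close>

lemma card_inversions_swap_less:
  assumes "a < b" "w \<langle>$\<rangle> a < w \<langle>$\<rangle> b"
  shows "card (inversions w) < card (inversions (w * \<langle>a \<leftrightarrow> b\<rangle>))"
proof -
  let ?t = "\<lambda>c. \<langle>a \<leftrightarrow> b\<rangle> \<langle>$\<rangle> c"
  define \<phi> where "\<phi> = (\<lambda>(c, d). if ?t c < ?t d then (?t c, ?t d) else (c, d))"
  have tt: "?t (?t c) = c" for c by (simp add: apply_swap)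
  have "inj_on \<phi> (inversions w)"
    unfolding inj_on_def \<phi>_def inversions_def by (clarsimp split: if_splits) (metis tt order.asym)
  moreover have "\<phi> ` inversions w \<subset> inversions (w * \<langle>a \<leftrightarrow> b\<rangle>)"
  proof
    show "\<phi> ` inversions w \<subseteq> inversions (w * \<langle>a \<leftrightarrow> b\<rangle>)"
      using assms by (auto simp: \<phi>_def inversions_def apply_times apply_swap split: if_splits)
    have "(a, b) \<in> inversions (w * \<langle>a \<leftrightarrow> b\<rangle>)"
      using assms by (auto simp: inversions_def apply_times)
    moreover have "(a, b) \<notin> \<phi> ` inversions w"
      using assms by (auto simp: \<phi>_def inversions_def apply_swap split: if_splits)
    ultimately show "\<phi> ` inversions w \<noteq> inversions (w * \<langle>a \<leftrightarrow> b\<rangle>)" by blast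
  qed
  ultimately show ?thesis
    by (metis card_image finite psubset_card_mono)
qed

text \<open>Nothing lies strictly between \<open>i\<close> and \<open>nxt i\<close>, so exchanging
  them reverses the order of this pair only.\<close>

lemma simple_less_iff:
  assumes "\<exists>k. i < k" "{c, d} \<noteq> {i, nxt i}"
  shows "simple i \<langle>$\<rangle> c < simple i \<langle>$\<rangle> d \<longleftrightarrow> c < d"
proof -
  have lt: "i < nxt i" using nxt_greater[OF assms(1)] .
  have outside: "x < nxt i \<longleftrightarrow> x < i" "nxt i < x \<longleftrightarrow> i < x" if "x \<noteq> i" "x \<noteq> nxt i" for x
  proof -
    consider "x < i" | "i < x" using \<open>x \<noteq> i\<close> by (rule linorder_neqE)
    then have "(x < nxt i \<longleftrightarrow> x < i) \<and> (nxt i < x \<longleftrightarrow> i < x)"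
    proof cases
      case 1
      then show ?thesis using lt by auto
    next
      case 2
      then have "nxt i < x" using nxt_le[OF 2] \<open>x \<noteq> nxt i\<close> by simp
      with 2 show ?thesis by auto
    qed
    then show "x < nxt i \<longleftrightarrow> x < i" "nxt i < x \<longleftrightarrow> i < x" by auto
  qed
  have "i \<noteq> nxt i" using lt by simp
  then show ?thesis
    using assms(2) lt
    by (cases "c = i"; cases "c = nxt i"; cases "d = i"; cases "d = nxt i")
      (simp_all add: simple_apply outside insert_commute)
qed

lemma card_inversions_simple_mult:
  assumes "\<exists>k. i < k" "inverse w \<langle>$\<rangle> i < inverse w \<langle>$\<rangle> (nxt i)"
  shows "card (inversions (simple i * w)) = Suc (card (inversions w))"
proof -
  let ?a = "inverse w \<langle>$\<rangle> i" and ?b = "inverse w \<langle>$\<rangle> (nxt i)"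
  have "(c, d) \<in> inversions (simple i * w) \<longleftrightarrow> (c, d) = (?a, ?b) \<or> (c, d) \<in> inversions w" for c d
  proof (cases "{w \<langle>$\<rangle> d, w \<langle>$\<rangle> c} = {i, nxt i}")
    case True
    then consider "d = ?a" "c = ?b" | "d = ?b" "c = ?a"
      unfolding doubleton_eq_iff by (metis inverse_apply_apply(1))
    then show ?thesis
      using assms(2) nxt_greater[OF assms(1)]
      by cases (auto simp: inversions_def apply_times simple_apply)
  next
    case False
    then have "(c, d) \<noteq> (?a, ?b)" by auto
    then show ?thesis
      using simple_less_iff[OF assms(1) False] by (auto simp: inversions_def apply_times)
  qed
  then have "inversions (simple i * w) = insert (?a, ?b) (inversions w)" by auto
  moreover have "(?a, ?b) \<notin> inversions w"
    using nxt_greater[OF assms(1)] by (simp add: inversions_def not_less less_imp_le)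
  ultimately show ?thesis by simp
qed

text \<open>Phrased by the positions of two adjacent values rather than by length. The first
  conjunct excludes the largest element, where \<open>nxt\<close> is unspecified.\<close>

definition left_descent :: "'n::{finite,linorder} \<Rightarrow> 'n perm \<Rightarrow> bool" where
  "left_descent i w \<longleftrightarrow> (\<exists>k. i < k) \<and> inverse w \<langle>$\<rangle> (nxt i) < inverse w \<langle>$\<rangle> i"

lemma left_descent_simple_mult:
  assumes "\<exists>k. i < k"
  shows "left_descent i (simple i * w) \<longleftrightarrow> \<not> left_descent i w"
proof -
  have "inverse w \<langle>$\<rangle> i \<noteq> inverse w \<langle>$\<rangle> (nxt i)"
    using nxt_greater[OF assms] by (metis inverse_apply_apply(2) less_irrefl)
  then show ?thesis
    using assms by (auto simp: left_descent_def apply_times simple_apply not_less_iff_gr_or_eq)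
qed

lemma card_inversions_simple_ascent:
  assumes "\<exists>k. i < k" "\<not> left_descent i w"
  shows "card (inversions (simple i * w)) = Suc (card (inversions w))"
proof (rule card_inversions_simple_mult)
  have "left_descent i (simple i * w)" using assms left_descent_simple_mult by blast
  then show "inverse w \<langle>$\<rangle> i < inverse w \<langle>$\<rangle> (nxt i)"
    using less_imp_neq[OF nxt_greater[OF assms(1)]] by (auto simp: left_descent_def apply_times simple_apply)
qed fact

lemma card_inversions_descent:
  assumes "left_descent i w"
  shows "card (inversions w) = Suc (card (inversions (simple i * w)))"
  using card_inversions_simple_ascent[of i "simple i * w"] assms left_descent_simple_mult[of i w]
  by (simp add: left_descent_def)

lemma inversions_1 [simp]: "inversions 1 = {}"
  by (auto simp: inversions_def)

text \<open>Without inversions \<open>w\<close> preserves the order, hence \<open>a\<close> and its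
  image have equally many predecessors.\<close>

lemma inversions_empty_imp_1:
  assumes "inversions w = {}"
  shows "w = 1"
proof (rule perm_eqI)
  fix a
  have mono: "w \<langle>$\<rangle> c < w \<langle>$\<rangle> d \<longleftrightarrow> c < d" for c d
  proof (cases c d rule: linorder_cases)
    case less
    then have "\<not> w \<langle>$\<rangle> d < w \<langle>$\<rangle> c"
      using assms by (auto simp: inversions_def)
    with less show ?thesis
      by (cases "w \<langle>$\<rangle> c" "w \<langle>$\<rangle> d" rule: linorder_cases) auto
  next
    case greater
    then have "\<not> w \<langle>$\<rangle> c < w \<langle>$\<rangle> d"
      using assms by (auto simp: inversions_def)
    with greater show ?thesis by auto
  qed simp
  have "{x. x < w \<langle>$\<rangle> a} = (\<lambda>x. w \<langle>$\<rangle> x) ` {x. x < a}"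
  proof (intro equalityI subsetI)
    fix x assume "x \<in> {x. x < w \<langle>$\<rangle> a}"
    then show "x \<in> (\<lambda>x. w \<langle>$\<rangle> x) ` {x. x < a}"
      by (intro image_eqI[of _ _ "inverse w \<langle>$\<rangle> x"]) (use mono[of "inverse w \<langle>$\<rangle> x" a] in auto)
  qed (auto simp: mono)
  then have eq: "card {x. x < w \<langle>$\<rangle> a} = card {x. x < a}"
    by (simp add: card_image inj_on_def)
  have less: "card {x. x < c} < card {x. x < d}" if "c < d" for c d :: 'a
    using that by (intro psubset_card_mono) auto
  show "w \<langle>$\<rangle> a = 1 \<langle>$\<rangle> a"
    using less[of "w \<langle>$\<rangle> a" a] less[of a "w \<langle>$\<rangle> a"] eq
    by (cases "w \<langle>$\<rangle> a" a rule: linorder_cases) simp_all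
qed

text \<open>An inversion of \<open>inverse w\<close> at \<open>a < b\<close> either occurs already
  between \<open>a\<close> and \<open>nxt a\<close> or persists between \<open>nxt a\<close> and
  \<open>b\<close>; moving \<open>a\<close> up finds an adjacent one.\<close>

lemma ex_left_descent:
  fixes w :: "'n::{finite,linorder} perm"
  assumes "w \<noteq> 1"
  shows "\<exists>i. left_descent i w"
proof -
  let ?g = "\<lambda>a. inverse w \<langle>$\<rangle> a"
  have "inverse w \<noteq> 1" using assms by (metis perm.inverse_inverse perm.inverse_neutral)
  then obtain a b where "a < b" "?g b < ?g a"
    using inversions_empty_imp_1[of "inverse w"] by (auto simp: inversions_def)
  then show ?thesis
  proof (induction "card {a<..b}" arbitrary: a rule: less_induct)
    case less
    have nxt: "a < nxt a" "nxt a \<le> b"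
      using nxt_greater[of a] nxt_le[OF less.prems(1)] less.prems(1) by auto
    show ?case
    proof (cases "?g (nxt a) < ?g a")
      case True
      then show ?thesis using less.prems by (auto simp: left_descent_def)
    next
      case False
      then have "nxt a \<noteq> b" "?g b < ?g (nxt a)" using less.prems by auto
      moreover have "{nxt a<..b} \<subset> {a<..b}"
      proof
        show "{nxt a<..b} \<subseteq> {a<..b}" using nxt by auto
        show "{nxt a<..b} \<noteq> {a<..b}" using nxt by (metis greaterThanAtMost_iff less_irrefl)
      qed
      ultimately show ?thesis
        using less.hyps[of "nxt a"] nxt psubset_card_mono[of "{a<..b}" "{nxt a<..b}"] by simp
    qed
  qed
qed

section \<open>Reduced words\<close>

lemma word_perm_simps [simp]: "word_perm [] = 1" "word_perm (i # ws) = simple i * word_perm ws"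
  by (simp_all add: word_perm_def)

lemma simple_word_simps [simp]:
  "simple_word []" "simple_word (i # ws) \<longleftrightarrow> (\<exists>k. i < k) \<and> simple_word ws"
  by (auto simp: simple_word_def)

lemma card_inversions_le_length: "simple_word ws \<Longrightarrow> card (inversions (word_perm ws)) \<le> length ws"
proof (induction ws)
  case (Cons i ws)
  then show ?case
    using card_inversions_simple_ascent[of i "word_perm ws"] card_inversions_descent[of i "word_perm ws"]
    by (cases "left_descent i (word_perm ws)") auto
qed simp

lemma ex_word_inversions:
  "\<exists>ws. simple_word ws \<and> word_perm ws = w \<and> length ws = card (inversions w)"
proof (induction "card (inversions w)" arbitrary: w rule: less_induct)
  case less
  show ?case
  proof (cases "w = 1")
    case True
    then show ?thesis by (intro exI[of _ "[]"]) simp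
  next
    case False
    then obtain i where i: "left_descent i w" using ex_left_descent by blast
    then obtain ws where "simple_word ws" "word_perm ws = simple i * w"
        "length ws = card (inversions (simple i * w))"
      using less[of "simple i * w"] card_inversions_descent[OF i] by auto
    then show ?thesis
      using i card_inversions_descent[OF i] by (intro exI[of _ "i # ws"]) (simp add: left_descent_def)
  qed
qed

lemma perm_length_eq: "perm_length w = card (inversions w)"
  unfolding perm_length_def
  by (rule Least_equality) (use ex_word_inversions card_inversions_le_length in blast)+

lemma ex_reduced_word: "\<exists>ws. reduced_word ws w"
  using ex_word_inversions by (simp add: reduced_word_def perm_length_eq)

lemma reduced_word_Nil_iff: "reduced_word ws 1 \<longleftrightarrow> ws = []"
  by (auto simp: reduced_word_def perm_length_eq)

lemma reduced_word_Cons_iff: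
  "reduced_word (i # ws) w \<longleftrightarrow> left_descent i w \<and> reduced_word ws (simple i * w)"
proof
  assume r: "reduced_word (i # ws) w"
  then have w: "simple i * w = word_perm ws" and i: "\<exists>k. i < k"
    by (auto simp: reduced_word_def)
  have "left_descent i w"
  proof (rule ccontr)
    assume "\<not> left_descent i w"
    from card_inversions_simple_ascent[OF i this] show False
      using r card_inversions_le_length[of ws] by (auto simp: reduced_word_def perm_length_eq w)
  qed
  with card_inversions_descent[OF this] show "left_descent i w \<and> reduced_word ws (simple i * w)"
    using r w by (simp add: reduced_word_def perm_length_eq)
next
  assume "left_descent i w \<and> reduced_word ws (simple i * w)"
  with card_inversions_descent[of i w] show "reduced_word (i # ws) w"
    by (simp add: reduced_word_def perm_length_eq left_descent_def)
qed

lemma left_descent_simple_iff: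
  assumes "j \<noteq> i" "j \<noteq> nxt i" "nxt j \<noteq> i" "i \<noteq> nxt i \<Longrightarrow> nxt j \<noteq> nxt i"
  shows "left_descent j (simple i * w) \<longleftrightarrow> left_descent j w"
  using assms by (cases "i = nxt i") (auto simp: left_descent_def apply_times simple_apply)

lemma nxt_inj: "\<exists>k. i < k \<Longrightarrow> \<exists>k. j < k \<Longrightarrow> nxt i = nxt j \<Longrightarrow> i = j"
  using nxt_le[of i j] nxt_le[of j i] nxt_greater[of i] nxt_greater[of j]
  by (cases i j rule: linorder_cases) auto

lemma simple_commute:
  assumes "i \<noteq> j" "i \<noteq> nxt j" "nxt i \<noteq> j" "nxt i \<noteq> nxt j"
  shows "simple i * simple j = simple j * simple i"
  using assms by (intro perm_eqI) (auto simp: apply_times simple_apply)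

lemma simple_braid:
  assumes "i \<noteq> nxt i" "nxt i \<noteq> nxt (nxt i)" "i \<noteq> nxt (nxt i)"
  shows "simple i * (simple (nxt i) * simple i) = simple (nxt i) * (simple i * simple (nxt i))"
  using assms by (intro perm_eqI) (auto simp: apply_times simple_apply)

text \<open>Matsumoto's theorem.  If two reduced words begin with distinct letters \<open>i\<close> and \<open>j\<close>, compare
  both with reduced words beginning with the two sides of the Coxeter relation between \<open>i\<close> and \<open>j\<close>.\<close>

lemma reduced_words_eval_eq:
  fixes t :: "'n::{finite,linorder} \<Rightarrow> 'm::monoid_mult"
  assumes commute: "\<And>i j. \<exists>k. i < k \<Longrightarrow> \<exists>k. j < k \<Longrightarrow> i \<noteq> j \<Longrightarrow> nxt i \<noteq> j \<Longrightarrow> nxt j \<noteq> i \<Longrightarrow> t i * t j = t j * t i"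
    and braid: "\<And>i. \<exists>k. i < k \<Longrightarrow> \<exists>k. nxt i < k \<Longrightarrow> t i * t (nxt i) * t i = t (nxt i) * t i * t (nxt i)"
    and "reduced_word ws w" "reduced_word vs w"
  shows "prod_list (map t ws) = prod_list (map t vs)"
  using assms(3,4)
proof (induction "length ws" arbitrary: ws vs w rule: less_induct)
  case less
  show ?case
  proof (cases ws)
    case Nil
    then have "vs = []" using less.prems by (auto simp: reduced_word_def)
    with Nil show ?thesis by simp
  next
    case ws: (Cons i us)
    then obtain j js where vs: "vs = j # js"
      using less.prems by (cases vs) (auto simp: reduced_word_def)
    have i: "left_descent i w" "reduced_word us (simple i * w)"
      and j: "left_descent j w" "reduced_word js (simple j * w)"
      using less.prems ws vs by (auto simp: reduced_word_Cons_iff)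
    have len: "length us < length ws" "length js < length ws"
      using less.prems ws vs by (auto simp: reduced_word_def)
    have ex: "\<exists>k. i < k" "\<exists>k. j < k"
      using i j by (auto simp: left_descent_def)
    have adjacent: "t p * prod_list (map t ps) = t (nxt p) * prod_list (map t qs)"
      if p: "left_descent p w" "reduced_word ps (simple p * w)" "length ps < length ws"
        and q: "left_descent (nxt p) w" "reduced_word qs (simple (nxt p) * w)" "length qs < length ws"
      for p ps qs
    proof -
      define q where "q = nxt p"
      define r where "r = nxt q"
      have ex: "\<exists>k. p < k" "\<exists>k. q < k" using p(1) q(1) by (auto simp: left_descent_def q_def)
      then have lt: "p < q" "q < r" using nxt_greater by (auto simp: q_def r_def)
      then have ne: "p \<noteq> q" "q \<noteq> r" "p \<noteq> r" by auto
      define x where "x = simple p * (simple q * (simple p * w))"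
      have x: "x = simple q * (simple p * (simple q * w))"
        using simple_braid[of p] ne unfolding x_def q_def r_def by (simp flip: mult.assoc)
      obtain zs where zs: "reduced_word zs x" using ex_reduced_word by blast
      \<comment> \<open>Two adjacent descents put the values \<open>p\<close>, \<open>q\<close>,
        \<open>r\<close> in reverse order in \<open>w\<close>, so each of the three letters leading
        from \<open>w\<close> to \<open>x\<close> is a descent, on either side of the braid
        relation.\<close>
      have g: "inverse w \<langle>$\<rangle> r < inverse w \<langle>$\<rangle> q" "inverse w \<langle>$\<rangle> q < inverse w \<langle>$\<rangle> p"
        using p(1) q(1) by (auto simp: left_descent_def q_def r_def)
      then have "inverse w \<langle>$\<rangle> r < inverse w \<langle>$\<rangle> p" by simp
      with g have "left_descent q (simple p * w)" "left_descent p (simple q * (simple p * w))"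
        "left_descent p (simple q * w)" "left_descent q (simple p * (simple q * w))"
        using ex ne by (auto simp: left_descent_def apply_times simple_apply simp flip: q_def r_def)
      with zs have "reduced_word (q # p # zs) (simple p * w)" "reduced_word (p # q # zs) (simple q * w)"
        by (auto simp: reduced_word_Cons_iff simp flip: x_def x)
      then have "prod_list (map t ps) = t q * (t p * prod_list (map t zs))"
        "prod_list (map t qs) = t p * (t q * prod_list (map t zs))"
        using less.hyps[OF p(3) p(2)] less.hyps[OF q(3) q(2)] by (auto simp: q_def)
      then show ?thesis
        using braid[OF ex(1) ex(2)[unfolded q_def]] by (simp add: q_def flip: mult.assoc)
    qed
    consider "i = j" | "nxt i = j" | "nxt j = i" | "i \<noteq> j" "nxt i \<noteq> j" "nxt j \<noteq> i" by blast
    then show ?thesis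
    proof cases
      case 1
      then show ?thesis using less.hyps[OF len(1) i(2)] j ws vs by simp
    next
      case 2
      then show ?thesis using adjacent[of i us js] i j len ws vs by simp
    next
      case 3
      then show ?thesis using adjacent[of j js us] i j len ws vs by simp
    next
      case 4
      then have ne: "nxt i \<noteq> nxt j" using nxt_inj ex by blast
      have comm: "simple i * simple j = simple j * simple i"
        using 4 ne by (intro simple_commute) auto
      obtain zs where zs: "reduced_word zs (simple i * (simple j * w))" using ex_reduced_word by blast
      have "left_descent j (simple i * w)" "left_descent i (simple j * w)"
        using i(1) j(1) 4 ne by (simp_all add: left_descent_simple_iff)
      then have "reduced_word (j # zs) (simple i * w)" "reduced_word (i # zs) (simple j * w)"
        using zs comm by (simp_all add: reduced_word_Cons_iff) (metis mult.assoc)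
      then have "prod_list (map t us) = t j * prod_list (map t zs)"
        "prod_list (map t js) = t i * prod_list (map t zs)"
        using less.hyps[OF len(1) i(2)] less.hyps[OF len(2) j(2)] by auto
      then show ?thesis
        using commute[OF ex 4] ws vs by (simp flip: mult.assoc)
    qed
  qed
qed

section \<open>Bruhat order\<close>

lemma bruhat_step_swap:
  assumes "a < b" "w \<langle>$\<rangle> a < w \<langle>$\<rangle> b"
  shows "bruhat_step w (w * \<langle>a \<leftrightarrow> b\<rangle>)"
  unfolding bruhat_step_def perm_length_eq
  using card_inversions_swap_less[OF assms] less_imp_neq[OF assms(1)] by blast

lemma bruhat_stepE:
  assumes "bruhat_step v w"
  obtains a b where "a < b" "w = v * \<langle>a \<leftrightarrow> b\<rangle>" "v \<langle>$\<rangle> a < v \<langle>$\<rangle> b"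
proof -
  obtain a b where ab: "a < b" "w = v * \<langle>a \<leftrightarrow> b\<rangle>"
    using assms unfolding bruhat_step_def by (metis linorder_neq_iff swap_sym)
  have v: "v = w * \<langle>a \<leftrightarrow> b\<rangle>" using ab(2) by (simp add: mult.assoc)
  have "\<not> v \<langle>$\<rangle> b < v \<langle>$\<rangle> a"
  proof
    assume "v \<langle>$\<rangle> b < v \<langle>$\<rangle> a"
    then have "w \<langle>$\<rangle> a < w \<langle>$\<rangle> b" by (simp add: ab(2) apply_times)
    from card_inversions_swap_less[OF ab(1) this] show False
      using assms by (simp add: bruhat_step_def perm_length_eq flip: v)
  qed
  then have "v \<langle>$\<rangle> a < v \<langle>$\<rangle> b"
    using ab(1) by (cases "v \<langle>$\<rangle> a" "v \<langle>$\<rangle> b" rule: linorder_cases) auto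
  then show thesis using that ab by auto
qed

lemma bruhat_step_simple:
  assumes "left_descent i w"
  shows "bruhat_step (simple i * w) w"
proof -
  have "w = simple i * w * \<langle>(inverse (simple i * w) \<langle>$\<rangle> i) \<leftrightarrow> (inverse (simple i * w) \<langle>$\<rangle> (nxt i))\<rangle>"
    using simple_mult_eq[of i "simple i * w"] by (simp only: simple_cancel)
  moreover have "inverse (simple i * w) \<langle>$\<rangle> i \<noteq> inverse (simple i * w) \<langle>$\<rangle> (nxt i)"
    unfolding apply_eq_iff using nxt_greater[of i] assms by (auto simp: left_descent_def)
  moreover have "card (inversions (simple i * w)) < card (inversions w)"
    using card_inversions_descent[OF assms] by simp
  ultimately show ?thesis
    unfolding bruhat_step_def perm_length_eq by blast
qed

text \<open>Follow the chain of Bruhat steps. A step exchanging the values \<open>i\<close> and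
  \<open>nxt i\<close> is itself left multiplication by \<open>simple i\<close>; any other step
  remains a step after this multiplication.\<close>

lemma bruhat_le_simple_mult:
  assumes "bruhat_le v w" "\<exists>k. i < k"
  shows "bruhat_le (simple i * v) (simple i * w) \<or> bruhat_le (simple i * v) w"
  using assms(1) unfolding bruhat_le_def
proof (induction rule: rtranclp_induct)
  case base
  then show ?case by simp
next
  case (step w w')
  obtain a b where ab: "a < b" "w' = w * \<langle>a \<leftrightarrow> b\<rangle>" "w \<langle>$\<rangle> a < w \<langle>$\<rangle> b"
    using step.hyps(2) by (rule bruhat_stepE)
  show ?case
  proof (cases "{w \<langle>$\<rangle> a, w \<langle>$\<rangle> b} = {i, nxt i}")
    case True
    then have "w \<langle>$\<rangle> a = i" "w \<langle>$\<rangle> b = nxt i"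
      using ab(3) nxt_greater[OF assms(2)] by (auto simp: doubleton_eq_iff)
    then have "inverse w \<langle>$\<rangle> i = a" "inverse w \<langle>$\<rangle> (nxt i) = b"
      by (metis inverse_apply_apply(1))+
    then have "simple i * w = w'"
      by (simp add: ab(2) simple_mult_eq)
    with step show ?thesis by auto
  next
    case False
    then have "bruhat_step (simple i * w) (simple i * w')"
      using bruhat_step_swap[OF ab(1), of "simple i * w"] simple_less_iff[OF assms(2) False] ab
      by (simp add: apply_times mult.assoc)
    with step show ?thesis by (meson rtranclp.rtrancl_into_rtrancl)
  qed
qed

lemma bruhat_le_subword:
  "reduced_word ws w \<Longrightarrow> bruhat_le (word_perm (nths ws J)) w"
proof (induction ws arbitrary: w J)
  case Nil
  then show ?case by (simp add: reduced_word_def bruhat_le_def)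
next
  case (Cons i ws)
  let ?J = "{j. Suc j \<in> J}"
  have i: "left_descent i w" "reduced_word ws (simple i * w)"
    using Cons.prems by (auto simp: reduced_word_Cons_iff)
  have le: "bruhat_le (word_perm (nths ws ?J)) (simple i * w)"
    using Cons.IH[OF i(2)] .
  have step: "bruhat_step (simple i * w) w" using bruhat_step_simple[OF i(1)] .
  have "bruhat_le v w" if "bruhat_le v (simple i * w)" for v
    using that step unfolding bruhat_le_def by (rule rtranclp.rtrancl_into_rtrancl)
  moreover have "bruhat_le (simple i * word_perm (nths ws ?J)) w \<or>
      bruhat_le (simple i * word_perm (nths ws ?J)) (simple i * w)"
    using bruhat_le_simple_mult[OF le, of i] i(1) by (auto simp: left_descent_def)
  ultimately show ?case
    using le by (auto simp: nths_Cons)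
qed

section \<open>The Coxeter relations\<close>

lemma basis_add: "basis a w v + basis b w v = basis (a + b) w v"
  by (rule tgalg_eqI) (simp add: plus_tgalg.rep_eq tcoeff_basis)

lemma basis_0 [simp]: "basis 0 w v = 0"
  by (rule tgalg_eqI) (simp add: zero_tgalg.rep_eq tcoeff_basis)

lemma basis_1 [simp]: "basis 1 1 1 = 1"
  by (rule tgalg_eqI) (simp add: one_tgalg.rep_eq tcoeff_basis)

lemma lookup_gens [simp]:
  "Poly_Mapping.lookup (zvar i) (Zgen j) = (if i = j then 1 else 0)"
  "Poly_Mapping.lookup (zvar i) Hgen = 0"
  "Poly_Mapping.lookup (lvar i) (Lgen j) = (if i = j then 1 else 0)"
  "Poly_Mapping.lookup (lvar i) Hgen = 0"
  "Poly_Mapping.lookup hbar Hgen = 1"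
  by (simp_all add: zvar_def lvar_def hbar_def lookup_single when_def)

lemma zvar_eq_iff [simp]: "zvar i = zvar j \<longleftrightarrow> i = j"
  by (metis lookup_gens(1) zero_neq_one)

lemma lvar_eq_iff [simp]: "lvar i = lvar j \<longleftrightarrow> i = j"
  by (metis lookup_gens(3) zero_neq_one)

lemma add_hbar_nonzero: "Poly_Mapping.lookup u Hgen = 0 \<Longrightarrow> u + hbar \<noteq> 0"
  by (auto simp: lat_eq_iff lookup_add intro!: exI[of _ Hgen])

text \<open>Moving \<open>deld (simple i)\<close> to the right exchanges the two \<lambda>
  variables, whence the reversed second argument.\<close>

lemma Tsimple_eq:
  "Tsimple i = basis (Pfun (zvar i - zvar (nxt i)) (lvar (nxt i) - lvar i)) 1 (simple i) +
    basis (Qfun (zvar i - zvar (nxt i)) (lvar (nxt i) - lvar i)) (simple i) (simple i)"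
  by (simp add: Tsimple_def distrib_left basis_mult act_Pfun act_Qfun act_lat_diff simple_apply)

lemma Tsimple_square:
  assumes "\<exists>k. i < k"
  shows "Tsimple i * Tsimple i = 1"
proof -
  let ?x = "zvar i - zvar (nxt i)" and ?a = "lvar (nxt i) - lvar i"
  have ne: "i \<noteq> nxt i" "nxt i \<noteq> i" using nxt_greater[OF assms] by auto
  have nz: "?x \<noteq> 0" "?a + hbar \<noteq> 0" "hbar - ?a \<noteq> 0"
    using add_hbar_nonzero[of ?a] add_hbar_nonzero[of "- ?a"] ne
    by (simp_all add: lookup_minus algebra_simps)
  have "Tsimple i * Tsimple i =
      basis (Pfun ?x ?a * Pfun ?x (- ?a) + Qfun ?x ?a * Qfun (- ?x) (- ?a)) 1 1 +
      basis (Pfun ?x ?a * Qfun ?x (- ?a) + Qfun ?x ?a * Pfun (- ?x) (- ?a)) (simple i) 1"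
    using ne by (simp add: Tsimple_eq algebra_simps basis_mult act_Pfun act_Qfun act_lat_diff simple_apply
        flip: basis_add)
  then show ?thesis
    unfolding PQ_square[OF nz] PQ_cross[OF nz] by simp
qed

lemma Tsimple_commute:
  assumes "i \<noteq> j" "i \<noteq> nxt j" "nxt i \<noteq> j" "nxt i \<noteq> nxt j"
  shows "Tsimple i * Tsimple j = Tsimple j * Tsimple i"
  using assms simple_commute[OF assms]
  by (simp add: Tsimple_eq distrib_left distrib_right basis_mult act_Pfun act_Qfun act_lat_diff simple_apply
      mult.commute add_ac)

text \<open>With \<open>t = s\<close> both sides of the braid relation are instances; if
  \<open>s * s = 1\<close>, the eight terms then fall on six permutations.\<close>

lemma basis_triple_mult:
  "(basis a 1 s + basis a' s s) * (basis b 1 r + basis b' r r) * (basis c 1 t + basis c' t t) =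
    basis (a * act 1 s b * act 1 (s * r) c) 1 (s * (r * t)) +
    basis (a * act 1 s b * act 1 (s * r) c') t (s * (r * t)) +
    basis (a * act 1 s b' * act r (s * r) c) r (s * (r * t)) +
    basis (a * act 1 s b' * act r (s * r) c') (r * t) (s * (r * t)) +
    basis (a' * act s s b * act s (s * r) c) s (s * (r * t)) +
    basis (a' * act s s b * act s (s * r) c') (s * t) (s * (r * t)) +
    basis (a' * act s s b' * act (s * r) (s * r) c) (s * r) (s * (r * t)) +
    basis (a' * act s s b' * act (s * r) (s * r) c') (s * (r * t)) (s * (r * t))"
  by (simp add: distrib_left distrib_right basis_mult mult.assoc add_ac)

text \<open>Compare coefficients at six permutations: \<open>PQ_cubic\<close> for the identity,
  \<open>PQ_fay\<close> for each simple transposition, \<open>QQ_swap\<close> for products of two,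
  and commutativity for the longest.\<close>

lemma Tsimple_braid:
  assumes "\<exists>k. i < k" "\<exists>k. nxt i < k"
  shows "Tsimple i * Tsimple (nxt i) * Tsimple i = Tsimple (nxt i) * Tsimple i * Tsimple (nxt i)"
proof -
  define j where "j = nxt i"
  define k where "k = nxt j"
  have lt: "i < j" "j < k" using nxt_greater assms by (auto simp: j_def k_def)
  then have ne: "i \<noteq> j" "j \<noteq> k" "i \<noteq> k" "j \<noteq> i" "k \<noteq> j" "k \<noteq> i" by auto
  define x y a b where "x = zvar i - zvar j" and "y = zvar j - zvar k"
    and "a = lvar j - lvar i" and "b = lvar k - lvar j"
  note defs = x_def y_def a_def b_def
  let ?s = "simple i" and ?r = "simple j"
  have s: "?s \<langle>$\<rangle> i = j" "?s \<langle>$\<rangle> j = i" "?s \<langle>$\<rangle> k = k"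
    and r: "?r \<langle>$\<rangle> i = i" "?r \<langle>$\<rangle> j = k" "?r \<langle>$\<rangle> k = j"
    using ne by (auto simp: simple_apply simp flip: j_def k_def)
  have srs: "?s * (?r * ?s) = ?r * (?s * ?r)"
    using simple_braid[of i] ne by (simp add: j_def k_def)
  have nz: "x \<noteq> 0" "y \<noteq> 0" "x + y \<noteq> 0" "a + hbar \<noteq> 0" "b + hbar \<noteq> 0" "a + b + hbar \<noteq> 0"
    "y + x \<noteq> 0" "b + a + hbar \<noteq> 0"
    using ne by (simp_all add: defs add_hbar_nonzero lookup_minus)
  have ti: "Tsimple i = basis (Pfun x a) 1 ?s + basis (Qfun x a) ?s ?s"
    and tj: "Tsimple j = basis (Pfun y b) 1 ?r + basis (Qfun y b) ?r ?r"
    by (simp_all add: Tsimple_eq defs j_def k_def)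
  have act_lat:
    "act_lat w ?s b = a + b" "act_lat w ?r a = a + b" "act_lat w (?s * ?r) a = b" "act_lat w (?r * ?s) b = a"
    "act_lat 1 v x = x" "act_lat ?s v x = - x" "act_lat ?r v x = x + y" "act_lat (?s * ?r) v x = y"
    "act_lat 1 v y = y" "act_lat ?r v y = - y" "act_lat ?s v y = x + y" "act_lat (?r * ?s) v y = x" for w v
    using s r by (simp_all add: defs act_lat_diff apply_times)
  have QQQ: "Qfun x a * Qfun (x + y) (a + b) * Qfun y b = Qfun y b * Qfun (x + y) (a + b) * Qfun x a"
    by (simp only: mult_ac)
  have QQP: "Qfun x a * Qfun (x + y) (a + b) * Pfun y b = Pfun y b * Qfun x (a + b) * Qfun (x + y) a"
    "Pfun x a * Qfun y (a + b) * Qfun (x + y) b = Qfun y b * Qfun (x + y) (a + b) * Pfun x a"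
    using QQ_swap[of x a "x + y" "a + b"] QQ_swap[of y b "x + y" "a + b"] by (simp_all add: mult_ac)
  have "Tsimple i * Tsimple j * Tsimple i =
    basis (Pfun x a * Pfun y (a + b) * Pfun x b + Qfun x a * Pfun (x + y) (a + b) * Qfun (- x) b) 1 (?s * (?r * ?s)) +
    basis (Pfun x a * Pfun y (a + b) * Qfun x b + Qfun x a * Pfun (x + y) (a + b) * Pfun (- x) b) ?s (?s * (?r * ?s)) +
    basis (Pfun x a * Qfun y (a + b) * Pfun (x + y) b) ?r (?s * (?r * ?s)) +
    basis (Pfun x a * Qfun y (a + b) * Qfun (x + y) b) (?r * ?s) (?s * (?r * ?s)) +
    basis (Qfun x a * Qfun (x + y) (a + b) * Pfun y b) (?s * ?r) (?s * (?r * ?s)) +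
    basis (Qfun x a * Qfun (x + y) (a + b) * Qfun y b) (?s * (?r * ?s)) (?s * (?r * ?s))"
    unfolding ti tj basis_triple_mult act_Pfun act_Qfun act_lat
    by (simp add: add_ac flip: basis_add)
  also have "\<dots> =
    basis (Pfun y b * Pfun x (a + b) * Pfun y a + Qfun y b * Pfun (x + y) (a + b) * Qfun (- y) a) 1 (?r * (?s * ?r)) +
    basis (Pfun y b * Pfun x (a + b) * Qfun y a + Qfun y b * Pfun (x + y) (a + b) * Pfun (- y) a) ?r (?r * (?s * ?r)) +
    basis (Pfun y b * Qfun x (a + b) * Pfun (x + y) a) ?s (?r * (?s * ?r)) +
    basis (Pfun y b * Qfun x (a + b) * Qfun (x + y) a) (?s * ?r) (?r * (?s * ?r)) +
    basis (Qfun y b * Qfun (x + y) (a + b) * Pfun x a) (?r * ?s) (?r * (?s * ?r)) +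
    basis (Qfun y b * Qfun (x + y) (a + b) * Qfun x a) (?r * (?s * ?r)) (?r * (?s * ?r))"
    unfolding srs QQQ QQP PQ_cubic[OF nz(1-6)] PQ_fay[OF nz(1-6)]
      PQ_fay[OF nz(2,1,7,5,4,8), unfolded add.commute[of y x] add.commute[of b a]]
    by (simp only: add_ac)
  also have "\<dots> = Tsimple j * Tsimple i * Tsimple j"
    unfolding ti tj basis_triple_mult act_Pfun act_Qfun act_lat
    by (simp add: add_ac flip: basis_add)
  finally show ?thesis by (simp add: j_def)
qed

section \<open>Expansion along a wiring diagram\<close>

lemma Tperm_eq:
  assumes "reduced_word ws w"
  shows "Tperm w = prod_list (map Tsimple ws)"
  unfolding Tperm_def
proof (rule reduced_words_eval_eq[OF _ _ someI[where P = "\<lambda>ws. reduced_word ws w", OF assms] assms])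
  fix i j :: 'a
  assume "\<exists>k. i < k" "\<exists>k. j < k" "i \<noteq> j" "nxt i \<noteq> j" "nxt j \<noteq> i"
  then show "Tsimple i * Tsimple j = Tsimple j * Tsimple i"
    using nxt_inj[of i j] by (intro Tsimple_commute) auto
qed (rule Tsimple_braid)

text \<open>At a descent the letter cancels against the first letter of a reduced word, by
  \<open>Tsimple_square\<close>. This is what admits words that are not reduced.\<close>

lemma Tsimple_mult_Tperm:
  assumes "\<exists>k. i < k"
  shows "Tsimple i * Tperm w = Tperm (simple i * w)"
proof -
  have ascent: "Tsimple i * Tperm v = Tperm (simple i * v)" if "\<not> left_descent i v" for v
  proof -
    obtain ws where ws: "reduced_word ws v" using ex_reduced_word by blast
    then have "reduced_word (i # ws) (simple i * v)"
      using that left_descent_simple_mult[OF assms, of v] by (simp add: reduced_word_Cons_iff)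
    from Tperm_eq[OF ws] Tperm_eq[OF this] show ?thesis by simp
  qed
  show ?thesis
  proof (cases "left_descent i w")
    case True
    then have "Tsimple i * Tperm (simple i * w) = Tperm w"
      using ascent[of "simple i * w"] left_descent_simple_mult[OF assms] by simp
    then have "Tsimple i * Tperm w = Tsimple i * Tsimple i * Tperm (simple i * w)"
      by (simp add: mult.assoc)
    then show ?thesis by (simp add: Tsimple_square[OF assms])
  qed (rule ascent)
qed

abbreviation twisted_T :: "'n::{finite,linorder} perm \<Rightarrow> 'n tgalg" where
  "twisted_T w \<equiv> deld (inverse w) * Tperm w"

text \<open>Solve the definition of \<open>Tsimple i\<close> for \<open>del (simple i)\<close> by
  \<open>QP_inverse\<close> and multiply by \<open>Tperm w\<close>. Moving the coefficients to the
  left of \<open>deld (inverse w)\<close> then turns the indices \<open>i\<close>,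
  \<open>nxt i\<close> of \<lambda> into blue labels.\<close>

lemma del_simple_mult_twisted_T:
  fixes i :: "'n::{finite,linorder}" and w :: "'n perm"
  assumes "\<exists>k. i < k"
  defines "z \<equiv> zvar i - zvar (nxt i)"
    and "l \<equiv> lvar (inverse w \<langle>$\<rangle> i) - lvar (inverse w \<langle>$\<rangle> (nxt i))"
  shows "del (simple i) * twisted_T w =
    scal (Pfun l z) * twisted_T w + scal (Qfun l z) * twisted_T (simple i * w)"
proof -
  let ?l = "lvar i - lvar (nxt i)" and ?s = "simple i"
  have "i \<noteq> nxt i" using nxt_greater[OF assms(1)] by auto
  then have nz: "?l \<noteq> 0" "z \<noteq> 0" "?l + hbar \<noteq> 0" "z + hbar \<noteq> 0"
    by (simp_all add: z_def add_hbar_nonzero lookup_minus)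
  have "deld ?s * deld ?s = (1 :: 'n tgalg)"
    by (simp add: basis_mult)
  then have "deld ?s * Tsimple i = scal (Pfun z ?l) + scal (Qfun z ?l) * del ?s"
    by (simp add: Tsimple_def z_def flip: mult.assoc)
  then have "scal (Pfun ?l z) + scal (Qfun ?l z) * (deld ?s * Tsimple i) =
      scal (Pfun ?l z + Qfun ?l z * Pfun z ?l) + scal (Qfun ?l z * Qfun z ?l) * del ?s"
    by (simp add: distrib_left basis_mult add.assoc flip: basis_add)
  also have "\<dots> = del ?s"
    unfolding QP_inverse[OF nz] by simp
  finally have "del ?s * Tperm w =
      (scal (Pfun ?l z) + scal (Qfun ?l z) * (deld ?s * Tsimple i)) * Tperm w"
    by (simp only:)
  then have "del ?s * Tperm w = scal (Pfun ?l z) * Tperm w + scal (Qfun ?l z) * deld ?s * Tperm (?s * w)"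
    by (simp add: distrib_right mult.assoc Tsimple_mult_Tperm[OF assms(1)])
  then have "deld (inverse w) * (del ?s * Tperm w) =
      deld (inverse w) * scal (Pfun ?l z) * Tperm w +
      deld (inverse w) * (scal (Qfun ?l z) * deld ?s) * Tperm (?s * w)"
    by (simp add: distrib_left mult.assoc)
  also have "deld (inverse w) * scal (Pfun ?l z) = scal (Pfun l z) * deld (inverse w)"
    by (simp add: basis_mult act_Pfun act_lat_diff l_def z_def)
  also have "deld (inverse w) * (scal (Qfun ?l z) * deld ?s) = scal (Qfun l z) * deld (inverse (?s * w))"
    by (simp add: basis_mult act_Qfun act_lat_diff l_def z_def)
  also have "deld (inverse w) * (del ?s * Tperm w) = del ?s * twisted_T w"
    by (simp add: basis_mult flip: mult.assoc)
  finally show ?thesis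
    by (simp only: mult.assoc)
qed

section \<open>Labels and weights of a diagram with a new first crossing\<close>

lemma red_height_eq: "j \<le> length ws \<Longrightarrow> red_height ws j h = inverse (word_perm (take j ws)) \<langle>$\<rangle> h"
proof (induction j)
  case (Suc j)
  have "word_perm (us @ vs) = word_perm us * word_perm vs" for us vs :: "'a list"
    by (simp add: word_perm_def)
  then show ?case
    using Suc by (simp add: take_Suc_conv_app_nth apply_times)
qed simp

lemma red_label_eq: "j \<le> length ws \<Longrightarrow> red_label ws j k = word_perm (take j ws) \<langle>$\<rangle> k"
  unfolding red_label_def by (rule the_equality) (auto simp: red_height_eq)

text \<open>Blue strings start at the right end, so the induction runs leftwards;
  \<open>{m. m + j \<in> J}\<close> renumbers the crossings that remain in
  \<open>drop j ws\<close>.\<close>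

lemma blue_height_eq:
  "j \<le> length ws \<Longrightarrow> blue_height ws J j h = word_perm (nths (drop j ws) {m. m + j \<in> J}) \<langle>$\<rangle> h"
proof (induction "length ws - j" arbitrary: j)
  case 0
  then show ?case by (simp add: blue_height.simps)
next
  case (Suc d)
  then have j: "j < length ws" by simp
  then have "drop j ws = ws ! j # drop (Suc j) ws"
    by (simp add: Cons_nth_drop_Suc)
  moreover have "blue_height ws J (Suc j) h =
      word_perm (nths (drop (Suc j) ws) {m. Suc m + j \<in> J}) \<langle>$\<rangle> h"
    using Suc by simp
  ultimately show ?case
    using j by (subst blue_height.simps) (simp add: nths_Cons apply_times)
qed

lemma blue_label_eq:
  "j \<le> length ws \<Longrightarrow>
    blue_label ws J j k = inverse (word_perm (nths (drop j ws) {m. m + j \<in> J})) \<langle>$\<rangle> k"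
  unfolding blue_label_def by (rule the_equality) (auto simp: blue_height_eq)

lemma act_prod: "act w v (prod f A) = (\<Prod>i\<in>A. act w v (f i))"
  by (induction A rule: infinite_finite_induct) (simp_all add: act_times)

text \<open>A new leftmost crossing exchanges the targets of two red strings and leaves the blue
  sources alone; hence the action on \<open>z\<close> only.\<close>

lemma local_weight_Cons_Suc:
  assumes "j < length ws"
  shows "local_weight (i # ws) J (Suc j) = act (simple i) 1 (local_weight ws {m. Suc m \<in> J} j)"
  using assms
  by (simp add: local_weight_def Let_def red_label_eq blue_label_eq act_Pfun act_Qfun act_lat_diff apply_times)

text \<open>Left of all crossings the red labels are the heights themselves, so these are the
  coefficients of \<open>del_simple_mult_twisted_T\<close>.\<close>

lemma local_weight_Cons_0:
  fixes i :: "'n::{finite,linorder}"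
  defines "z \<equiv> zvar i - zvar (nxt i)"
  shows "local_weight (i # ws) J 0 = (let v = inverse (diagram_perm ws {m. Suc m \<in> J});
      l = lvar (v \<langle>$\<rangle> i) - lvar (v \<langle>$\<rangle> (nxt i)) in if 0 \<in> J then Qfun l z else Pfun l z)"
  by (simp add: local_weight_def Let_def red_label_eq blue_label_eq diagram_perm_def z_def)

lemma weight_Cons:
  "weight (i # ws) J = local_weight (i # ws) J 0 * act (simple i) 1 (weight ws {m. Suc m \<in> J})"
  unfolding weight_def list.size(4) add_0_right One_nat_def add_Suc_right
  by (subst prod.lessThan_Suc_shift) (simp add: act_prod local_weight_Cons_Suc)

lemma diagram_perm_Cons:
  "diagram_perm (i # ws) J =
    (if 0 \<in> J then simple i * diagram_perm ws {m. Suc m \<in> J} else diagram_perm ws {m. Suc m \<in> J})"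
  by (simp add: diagram_perm_def nths_Cons)

lemma sum_Pow_lessThan_Suc:
  "(\<Sum>J\<in>Pow {..<Suc n}. f J) = (\<Sum>J\<in>Pow {..<n}. f (Suc ` J) + f (insert 0 (Suc ` J)))"
  for f :: "nat set \<Rightarrow> 'a::comm_monoid_add"
proof -
  have inj: "inj_on (\<lambda>J. Suc ` J) (Pow {..<n})" "inj_on (\<lambda>J. insert 0 (Suc ` J)) (Pow {..<n})"
    by (auto simp: inj_on_def)
  have "Pow {..<Suc n} = (\<lambda>J. Suc ` J) ` Pow {..<n} \<union> (\<lambda>J. insert 0 (Suc ` J)) ` Pow {..<n}"
    by (simp add: lessThan_Suc_eq_insert_0 Pow_insert image_Pow_surj[of Suc, symmetric] image_image)
  moreover have "(\<lambda>J. Suc ` J) ` Pow {..<n} \<inter> (\<lambda>J. insert 0 (Suc ` J)) ` Pow {..<n} = {}"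
    by auto
  ultimately show ?thesis
    by (simp add: sum.union_disjoint sum.reindex inj sum.distrib)
qed

text \<open>Induction along the word from the left: \<open>del (simple i)\<close> acts on the
  weights of the shorter diagram and then splits each \<open>twisted_T\<close> in two, the new
  crossing 0 being absent or present.\<close>

lemma del_word_perm_expansion:
  assumes "simple_word ws"
  shows "del (word_perm ws) =
    (\<Sum>J\<in>Pow {..<length ws}. scal (weight ws J) * twisted_T (diagram_perm ws J))"
  using assms
proof (induction ws)
  case Nil
  have "Tperm (1 :: 'a perm) = 1"
    using Tperm_eq[of "[]" "1 :: 'a perm"] by (simp add: reduced_word_Nil_iff)
  then show ?case
    by (simp add: weight_def diagram_perm_def)
next
  case (Cons i ws)
  let ?s = "simple i" and ?X = "\<lambda>J. twisted_T (diagram_perm ws J)"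
  have i: "\<exists>k. i < k" and ws: "simple_word ws" using Cons.prems by simp_all
  have "del (word_perm (i # ws)) = del ?s * del (word_perm ws)"
    by (simp add: basis_mult)
  also have "\<dots> = (\<Sum>J\<in>Pow {..<length ws}. del ?s * scal (weight ws J) * ?X J)"
    unfolding Cons.IH[OF ws] by (simp add: sum_distrib_left mult.assoc)
  also have "\<dots> = (\<Sum>J\<in>Pow {..<length ws}.
      scal (weight (i # ws) (Suc ` J)) * twisted_T (diagram_perm (i # ws) (Suc ` J)) +
      scal (weight (i # ws) (insert 0 (Suc ` J))) * twisted_T (diagram_perm (i # ws) (insert 0 (Suc ` J))))"
  proof (rule sum.cong[OF refl])
    fix J
    have J: "{m. Suc m \<in> Suc ` J} = J" "{m. Suc m \<in> insert 0 (Suc ` J)} = J" "0 \<notin> Suc ` J"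
      by auto
    have "del ?s * scal (weight ws J) * ?X J = scal (act ?s 1 (weight ws J)) * (del ?s * ?X J)"
      by (simp add: basis_mult flip: mult.assoc)
    then show "del ?s * scal (weight ws J) * ?X J =
      scal (weight (i # ws) (Suc ` J)) * twisted_T (diagram_perm (i # ws) (Suc ` J)) +
      scal (weight (i # ws) (insert 0 (Suc ` J))) * twisted_T (diagram_perm (i # ws) (insert 0 (Suc ` J)))"
      unfolding del_simple_mult_twisted_T[OF i] weight_Cons diagram_perm_Cons local_weight_Cons_0 Let_def J
      by (simp add: distrib_left basis_mult mult.commute flip: mult.assoc)
  qed
  also have "\<dots> = (\<Sum>J\<in>Pow {..<length (i # ws)}.
      scal (weight (i # ws) J) * twisted_T (diagram_perm (i # ws) J))"
    unfolding list.size(4) add_0_right One_nat_def add_Suc_right sum_Pow_lessThan_Suc ..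
  finally show ?case .
qed

definition diagram_sum :: "'n::{finite,linorder} list \<Rightarrow> 'n perm \<Rightarrow> 'n efield" where
  "diagram_sum ws w = (\<Sum>J | J \<subseteq> {..<length ws} \<and> diagram_perm ws J = w. weight ws J)"

lemma scal_sum: "scal (sum f A) = (\<Sum>x\<in>A. scal (f x))"
  by (induction A rule: infinite_finite_induct) (simp_all flip: basis_add)

lemma del_word_perm_eq_sum:
  assumes "simple_word ws"
  shows "del (word_perm ws) = (\<Sum>w\<in>UNIV. scal (diagram_sum ws w) * twisted_T w)"
proof -
  have "(\<Sum>w\<in>UNIV. scal (diagram_sum ws w) * twisted_T w) =
      (\<Sum>w\<in>UNIV. \<Sum>J\<in>{J \<in> Pow {..<length ws}. diagram_perm ws J = w}.
        scal (weight ws J) * twisted_T (diagram_perm ws J))"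
    by (simp add: diagram_sum_def scal_sum sum_distrib_right)
  also have "\<dots> = del (word_perm ws)"
    unfolding del_word_perm_expansion[OF assms] by (rule sum.group) auto
  finally show ?thesis by simp
qed

section \<open>Uniqueness of the coefficients\<close>

lemma tcoeff_scal_mult:
  fixes a :: "'n::{finite,linorder} tgalg"
  shows "tcoeff (scal c * a) x y = c * tcoeff a x y"
proof -
  have "tcoeff (scal c * a) x y =
      (\<Sum>w :: 'n perm\<in>UNIV. \<Sum>v :: 'n perm\<in>UNIV. if w = 1 then if v = 1 then c * tcoeff a x y else 0 else 0)"
    unfolding times_tgalg.rep_eq tcoeff_basis
    by (intro sum.cong refl) auto
  also have "\<dots> = (\<Sum>w :: 'n perm\<in>UNIV. if w = 1 then \<Sum>v :: 'n perm\<in>UNIV. if v = 1 then c * tcoeff a x y else 0 else 0)"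
    by (rule sum.cong) auto
  finally show ?thesis by simp
qed

lemma tcoeff_sum: "tcoeff (sum f A) x y = (\<Sum>i\<in>A. tcoeff (f i) x y)"
  by (induction A rule: infinite_finite_induct)
    (simp_all add: plus_tgalg.rep_eq zero_tgalg.rep_eq)

text \<open>The expansions of all \<open>\<delta>\<^sub>u\<close> provide a left inverse of the square matrix of coefficients
  of the \<^term>\<open>twisted_T w\<close>, which is therefore also a right inverse.\<close>

lemma twisted_T_independent:
  fixes b c :: "'n::{finite,linorder} perm \<Rightarrow> 'n efield"
  assumes "(\<Sum>w\<in>UNIV. scal (b w) * twisted_T w) = (\<Sum>w\<in>UNIV. scal (c w) * twisted_T w)"
  shows "b = c"
proof
  fix v
  obtain r where r: "reduced_word (r u) u" for u :: "'n perm"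
    using ex_reduced_word by metis
  \<comment> \<open>Coefficients at the trivial dual component suffice, since \<open>del u\<close>
    has no others; they form a square matrix indexed by permutations.\<close>
  define A :: "'n efield ^ 'n perm ^ 'n perm" where "A = (\<chi> w x. tcoeff (twisted_T w) x 1)"
  define B :: "'n efield ^ 'n perm ^ 'n perm" where "B = (\<chi> u w. diagram_sum (r u) w)"
  have "B ** A = mat 1"
  proof (simp add: vec_eq_iff, intro allI)
    fix u x
    have "del u = (\<Sum>w\<in>UNIV. scal (diagram_sum (r u) w) * twisted_T w)"
      using del_word_perm_eq_sum[of "r u"] r[of u] by (simp add: reduced_word_def)
    from arg_cong[OF this[symmetric], of "\<lambda>a. tcoeff a x 1"]
    show "(B ** A) $ u $ x = mat 1 $ u $ x"
      by (simp add: matrix_matrix_mult_def A_def B_def mat_def tcoeff_sum tcoeff_scal_mult tcoeff_basis)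
  qed
  then have AB: "A ** B = mat 1"
    by (simp add: matrix_left_right_inverse)
  have recover: "(\<Sum>x\<in>UNIV. tcoeff (\<Sum>w\<in>UNIV. scal (d w) * twisted_T w) x 1 * B $ x $ v) = d v" for d
  proof -
    have "(\<Sum>x\<in>UNIV. tcoeff (\<Sum>w\<in>UNIV. scal (d w) * twisted_T w) x 1 * B $ x $ v) =
        (\<Sum>x\<in>UNIV. \<Sum>w\<in>UNIV. d w * (A $ w $ x * B $ x $ v))"
      by (simp add: tcoeff_sum tcoeff_scal_mult A_def sum_distrib_right mult.assoc)
    also have "\<dots> = (\<Sum>w\<in>UNIV. d w * (A ** B) $ w $ v)"
      by (subst sum.swap) (simp add: matrix_matrix_mult_def sum_distrib_left)
    finally show ?thesis
      by (simp add: AB mat_def if_distrib[of "\<lambda>x. _ * x"] cong: if_cong)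
  qed
  show "b v = c v"
    using recover[of b] recover[of c] assms by simp
qed

text \<open>The sum over the Bruhat interval extends to all permutations because the added
  coefficients vanish; uniqueness is then \<open>twisted_T_independent\<close>.\<close>

lemma schubert_coeffs_eqI:
  assumes "\<And>w. \<not> bruhat_le w u \<Longrightarrow> b w = 0"
    and "del u = (\<Sum>w\<in>UNIV. scal (b w) * twisted_T w)"
  shows "schubert_coeffs u = b"
  unfolding schubert_coeffs_def
proof (rule the_equality)
  have extend: "(\<Sum>w | bruhat_le w u. scal (c w) * deld (inverse w) * Tperm w) =
      (\<Sum>w\<in>UNIV. scal (c w) * twisted_T w)" if "\<forall>w. \<not> bruhat_le w u \<longrightarrow> c w = 0" for c
    unfolding mult.assoc by (rule sum.mono_neutral_left) (use that in auto)
  show "(\<forall>w. \<not> bruhat_le w u \<longrightarrow> b w = 0) \<and>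
      del u = (\<Sum>w | bruhat_le w u. scal (b w) * deld (inverse w) * Tperm w)"
    using assms extend by auto
  fix c
  assume c: "(\<forall>w. \<not> bruhat_le w u \<longrightarrow> c w = 0) \<and>
      del u = (\<Sum>w | bruhat_le w u. scal (c w) * deld (inverse w) * Tperm w)"
  then show "c = b"
    using extend[of c] assms(2) by (intro twisted_T_independent) simp
qed

theorem theorem5p1:
  fixes u w :: "'n::{finite,linorder} perm" and ws :: "'n list"
  assumes "simple_word ws" and "u = word_perm ws"
  shows "ell_schubert w u =
    (\<Sum>J | J \<subseteq> {..<length ws} \<and> diagram_perm ws J = w. weight ws J)"
proof -
  \<comment> \<open>If \<open>ws\<close> is not reduced, it may have sub-diagrams whose permutation
    is not below \<open>u\<close>, and their weights have to cancel. Comparison with a reduced word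
    of \<open>u\<close> shows that they do.\<close>
  obtain rs where rs: "reduced_word rs u" using ex_reduced_word by blast
  have expansion: "del u = (\<Sum>w\<in>UNIV. scal (diagram_sum ws w) * twisted_T w)"
    using del_word_perm_eq_sum[OF assms(1)] assms(2) by simp
  also have "del u = (\<Sum>w\<in>UNIV. scal (diagram_sum rs w) * twisted_T w)"
    using del_word_perm_eq_sum[of rs] rs by (simp add: reduced_word_def)
  finally have eq: "diagram_sum ws = diagram_sum rs"
    by (rule twisted_T_independent[symmetric])
  have "schubert_coeffs u = diagram_sum ws"
  proof (rule schubert_coeffs_eqI[OF _ expansion])
    fix v assume "\<not> bruhat_le v u"
    then have "{J. J \<subseteq> {..<length rs} \<and> diagram_perm rs J = v} = {}"
      using bruhat_le_subword[OF rs] by (auto simp: diagram_perm_def)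
    then show "diagram_sum ws v = 0"
      unfolding eq diagram_sum_def by (simp only: sum.empty)
  qed
  then show ?thesis
    by (simp add: ell_schubert_def diagram_sum_def)
qed

end
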